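(* Let $a\geq 2$, $m\geq 0$ and $U\geq 0$ be integers. Put \[s_0=\left\lfloor \frac{2^U\log a}{(U+1)\log 2}\right\rfloor,\] and let $t_0=2s_0+1$ if $U=0$ and $a+1$ is a perfect square, and $t_0=2s_0$ otherwise. Let \[c=\frac{\log 2}{2}+\frac{\log 3}{3}-\frac{(\log 3)^2}{2},\] and let $C=C(U)$ be the constant \[C=\sum_{\substack{j\geq 0\\ 2^{U+1}(2j+1)<16}} \frac{1-\log\log\bigl(2^{U+1}(2j+1)\bigr)}{2^{U+1}(2j+1)}.\] Then: (1) If $n=2^U$ and $a^n+1$ is an odd $(4m+2)$-perfect number, then \[\log a>\frac{\bigl((4m+2)/e^{C}\bigr)^{2^{U+1}}}{2^U}.\] (2) If $n=2^U v$ with $v>1$ odd and $a^n+1$ is an odd $(4m+2)$-perfect number, then \[\log(4m+2)-C<\frac{\exp\left(\frac{1+\log t_0}{2^{U+1}}\right)}{2^{U+1}}\left(\log(2^U\log a)+(U+1)(1+\log t_0)\log 2+\frac{(\log t_0)^2}{2}+c\right).\] (3) For every positive integer $n$ and every nonnegative integer $m$, the integer $2^n+1$ is not $(4m+2)$-perfect.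
   Context: For a positive integer $N$, $\sigma(N)$ denotes the sum of the positive divisors of $N$. For a positive integer $k$, $N$ is called $k$-perfect if $\sigma(N)=kN$. $\lfloor x\rfloor$ is the floor function and $\log$ is the natural logarithm. *)

theory Defs
  imports "HOL-Analysis.Analysis" "HOL-Computational_Algebra.Nth_Powers"
begin

definition sigma :: "nat \<Rightarrow> nat" where
  "sigma N = (\<Sum>d | d dvd N. d)"

text \<open>Positivity of \<open>N\<close> has to be demanded explicitly: the divisor set of \<open>0\<close> is infinite, so
  \<open>sigma 0 = 0\<close> by convention.\<close>

definition k_perfect :: "nat \<Rightarrow> nat \<Rightarrow> bool" where
  "k_perfect k N \<longleftrightarrow> k > 0 \<and> N > 0 \<and> sigma N = k * N"

definition s0 :: "nat \<Rightarrow> nat \<Rightarrow> nat" where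
  "s0 a U = nat \<lfloor>2 ^ U * ln (real a) / (real (U + 1) * ln 2)\<rfloor>"

definition t0 :: "nat \<Rightarrow> nat \<Rightarrow> nat" where
  "t0 a U = (if U = 0 \<and> is_square (a + 1) then 2 * s0 a U + 1 else 2 * s0 a U)"

definition c_const :: real where
  "c_const = ln 2 / 2 + ln 3 / 3 - (ln 3)\<^sup>2 / 2"

definition C_const :: "nat \<Rightarrow> real" where
  "C_const U = (\<Sum>j | 2 ^ (U + 1) * (2 * j + 1) < (16 :: nat).
     (1 - ln (ln (real (2 ^ (U + 1) * (2 * j + 1))))) / real (2 ^ (U + 1) * (2 * j + 1)))"

end

theory Submission
  imports Defs "HOL-Number_Theory.Number_Theory"
begin

text \<open>
  Write \<open>A = a ^ (2 ^ U)\<close>, \<open>q = 2 ^ (U + 1)\<close> and \<open>N = A ^ v + 1\<close> with \<open>v\<close> odd. A prime factor of \<open>N\<close>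
  has \<open>q d\<close> as order of \<open>a\<close> for some \<open>d\<close> dividing \<open>v\<close>, so it is \<open>1\<close> modulo \<open>q d\<close> and divides
  \<open>A ^ d + 1\<close>. There are at most \<open>d ln A / ln (q d)\<close> such primes, so they contribute at most
  \<open>(1 + ln d + ln (ln A) - ln (ln (q d))) / (q d)\<close> to the sum of \<open>1 / (p - 1)\<close>, which bounds
  \<open>ln (sigma N / N)\<close>. Summing over \<open>d\<close> needs control of the primes dividing \<open>v\<close>.

  Since \<open>sigma N\<close> is \<open>2\<close> modulo \<open>4\<close>, exactly one prime has odd exponent in \<open>N\<close>. On the other hand
  \<open>(x ^ l + 1) / (x + 1)\<close> is never a square for even \<open>x\<close> and odd \<open>l > 1\<close>: otherwise the Pell-type equation
  \<open>(x + 1) Y^2 - x Z^2 = 1\<close> would have a solution with \<open>Z\<close> even. Building up \<open>A ^ W + 1\<close> from \<open>A + 1\<close>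
  by adjoining to the exponent, in decreasing order, the primes of \<open>v\<close> not dividing \<open>A + 1\<close>, each step
  thus adds a new prime with odd exponent. These must be the Euler prime or divisors of \<open>v\<close> dividing
  \<open>A + 1\<close>, and \<open>A + 1\<close> has at most \<open>s0\<close> prime factors. Hence \<open>v\<close> has at most \<open>t0\<close> prime factors.

  For \<open>a = 2\<close> the same estimates give \<open>sigma N < 2 N\<close> as soon as \<open>U\<close> is positive. When \<open>U = 0\<close>, the number
  \<open>(2 ^ l + 1) / 3\<close> is \<open>3\<close> modulo \<open>4\<close>, which is incompatible with the Euler prime being \<open>1\<close> modulo \<open>4\<close>
  when \<open>l > 3\<close> is the largest prime factor of \<open>v\<close>, and \<open>9\<close> dividing \<open>v\<close> is excluded by
  \<open>2 ^ 9 + 1 = 27 * 19\<close>.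
\<close>

subsection \<open>Squares and prime divisors of \<open>x ^ n + 1\<close>\<close>

text \<open>
  Multiplying by the inverse of the square of the smallest solution \<open>y = z = 1\<close> gives a smaller solution
  in which \<open>z\<close> has the same parity.
\<close>

lemma pell_descent_odd:
  fixes x y z :: int
  assumes "even x" "x > 0" "y > 0" "(x + 1) * y\<^sup>2 = x * z\<^sup>2 + 1"
  shows "odd z"
  using assms(3,4)
proof (induction "nat \<bar>z\<bar>" arbitrary: y z rule: less_induct)
  case less
  have eq: "(x + 1) * y\<^sup>2 = x * \<bar>z\<bar>\<^sup>2 + 1" using less.prems by simp
  define w where "w = \<bar>z\<bar>"
  have w: "(x + 1) * y\<^sup>2 = x * w\<^sup>2 + 1" "w \<ge> 0" using eq by (auto simp: w_def)
  have "w \<noteq> 0"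
  proof
    assume "w = 0"
    then have "(x + 1) * y\<^sup>2 = 1" using w by simp
    then have "x + 1 dvd 1" by (metis dvd_triv_left)
    then show False using assms(2) by auto
  qed
  show ?case
  proof (cases "w = 1")
    case True
    then show ?thesis by (auto simp: w_def abs_if split: if_splits)
  next
    case False
    with \<open>w \<noteq> 0\<close> w have "w > 1" by auto
    have "y < w"
    proof (rule ccontr)
      assume "\<not> y < w"
      then have "w\<^sup>2 \<le> y\<^sup>2" using w by (simp add: power_mono)
      then have "(x + 1) * w\<^sup>2 \<le> x * w\<^sup>2 + 1" using w assms(2) by (metis mult_left_mono add_nonneg_nonneg less_imp_le zero_le_one)
      then have "w\<^sup>2 \<le> 1" by (simp add: algebra_simps)
      then show False using \<open>w > 1\<close> by (smt (verit) one_less_power pos2)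
    qed
    \<comment> \<open>\<open>y'\<close> and \<open>z'\<close> are the coefficients of y sqrt(x+1) +
      w sqrt(x) multiplied by 2x + 1 - 2 sqrt(x(x+1)). As \<open>2 * x + 1\<close> is odd,
      \<open>z'\<close> and \<open>w\<close> have the same parity.\<close>
    define z' where "z' = (2 * x + 1) * w - 2 * (x + 1) * y"
    define y' where "y' = (2 * x + 1) * y - 2 * x * w"
    have eq': "(x + 1) * y'\<^sup>2 = x * z'\<^sup>2 + 1"
    proof -
      have "(x + 1) * y'\<^sup>2 - x * z'\<^sup>2 = (x + 1) * y\<^sup>2 - x * w\<^sup>2"
        unfolding y'_def z'_def by (simp add: power2_eq_square algebra_simps)
      then show ?thesis using w by simp
    qed
    have "(x * w)\<^sup>2 < ((x + 1) * y)\<^sup>2"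
    proof -
      have "((x + 1) * y)\<^sup>2 = (x + 1) * ((x + 1) * y\<^sup>2)" by (simp add: power2_eq_square)
      also have "\<dots> = (x + 1) * (x * w\<^sup>2 + 1)" using w by simp
      also have "\<dots> = (x * w)\<^sup>2 + (x * w\<^sup>2 + x + 1)" by (simp add: power2_eq_square algebra_simps)
      finally show ?thesis using assms(2) by (smt (verit) mult_nonneg_nonneg zero_le_power2)
    qed
    then have "x * w < (x + 1) * y" using assms(2) less.prems(1) by (simp add: power_less_imp_less_base)
    then have "z' < w" unfolding z'_def by (simp add: algebra_simps)
    moreover have "- w < z'" 
    proof -
      have "(x + 1) * y < (x + 1) * w" using \<open>y < w\<close> assms(2) by simp
      then show ?thesis unfolding z'_def by (simp add: algebra_simps)
    qed
    ultimately have small: "nat \<bar>z'\<bar> < nat \<bar>z\<bar>" by (auto simp: w_def)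
    have "(2 * x * w)\<^sup>2 < ((2 * x + 1) * y)\<^sup>2"
    proof -
      have "(2 * x * w)\<^sup>2 = 4 * x * (x * w\<^sup>2)" by (simp add: power2_eq_square)
      also have "\<dots> = 4 * x * ((x + 1) * y\<^sup>2 - 1)" using w by simp
      also have "\<dots> = ((2 * x + 1) * y)\<^sup>2 - y\<^sup>2 - 4 * x" by (simp add: power2_eq_square algebra_simps)
      finally show ?thesis using assms(2) by (smt (verit) zero_le_power2)
    qed
    then have "2 * x * w < (2 * x + 1) * y" using assms(2) less.prems(1) by (simp add: power_less_imp_less_base)
    then have "y' > 0" by (simp add: y'_def)
    from less.hyps[OF small this eq'] have "odd z'" .
    then have "odd w" unfolding z'_def by simp
    then show ?thesis by (auto simp: w_def)
  qed
qed

text \<open>\<open>Q\<close> is an alternating sum of \<open>n\<close> powers of \<open>x\<close>;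
  since \<open>x\<close> is -1 modulo \<open>x + 1\<close>, every signed term is 1. The congruence
  later settles the coprimality of \<open>Q\<close> and \<open>x + 1\<close> by looking at
  \<open>n\<close> alone.\<close>

lemma odd_power_plus_one_factor:
  fixes x n :: nat
  assumes "odd n"
  obtains Q where "x ^ n + 1 = (x + 1) * Q" "[Q = n] (mod (x + 1))"
proof -
  have "\<exists>Q. x ^ (2 * h + 1) + 1 = (x + 1) * Q \<and> [Q = 2 * h + 1] (mod (x + 1))" for h
  proof (induction h)
    case 0
    then show ?case by (intro exI[of _ 1]) auto
  next
    case (Suc h)
    then obtain Q where Q: "x ^ (2 * h + 1) + 1 = (x + 1) * Q" "[Q = 2 * h + 1] (mod (x + 1))" by blast
    have "Q \<ge> 1" using Q(1) by (cases Q) auto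
    \<comment> \<open>This makes the truncated subtraction in \<open>R\<close> exact.\<close>
    then have le: "x \<le> x\<^sup>2 * Q + 1" 
      by (cases x) (auto simp: power2_eq_square algebra_simps trans_le_add2)
    define R where "R = x\<^sup>2 * Q + 1 - x"
    have R: "R + x = x\<^sup>2 * Q + 1" using le by (simp add: R_def)
    have "x ^ (2 * Suc h + 1) + 1 + x\<^sup>2 = x\<^sup>2 * (x ^ (2 * h + 1) + 1) + 1"
      by (simp add: algebra_simps power2_eq_square)
    also have "\<dots> = (x + 1) * (x\<^sup>2 * Q) + 1" unfolding Q(1) by (simp add: algebra_simps)
    finally have "x ^ (2 * Suc h + 1) + 1 + x\<^sup>2 + x = (x + 1) * (R + x)"
      unfolding R by (simp add: algebra_simps)
    then have 1: "x ^ (2 * Suc h + 1) + 1 = (x + 1) * R"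
      by (simp add: algebra_simps power2_eq_square)
    have "R + (Q + 1) * (x + 1) = (Q + 2) + (x * Q) * (x + 1)"
      using R by (simp add: power2_eq_square algebra_simps)
    then have "[R + (Q + 1) * (x + 1) = (Q + 2) + (x * Q) * (x + 1)] (mod (x + 1))" by (simp only: cong_refl)
    then have "[R = Q + 2] (mod (x + 1))"
      unfolding cong_def by (simp only: mod_mult_self1)
    also have "[Q + 2 = 2 * h + 1 + 2] (mod (x + 1))" by (intro cong_add Q) simp
    finally have "[R = 2 * Suc h + 1] (mod (x + 1))" by simp
    with 1 show ?case by blast
  qed
  moreover from assms obtain h where "n = 2 * h + 1" by (elim oddE)
  ultimately show thesis using that by blast
qed

text \<open>With n = 2h + 1 and Q = y^2 the factorization becomes the Pell-type equation with z =
  x^h, which is even because h > 0; this contradicts \<open>pell_descent_odd\<close>.\<close>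

lemma odd_power_plus_one_quotient_not_square:
  fixes x n Q :: nat
  assumes "even x" "x > 0" "odd n" "n > 1" "x ^ n + 1 = (x + 1) * Q"
  shows "\<not> is_square Q"
proof
  assume "is_square Q"
  then obtain y where y: "Q = y\<^sup>2" by (auto elim: is_nth_powerE)
  obtain h where h: "n = 2 * h + 1" using assms(3) by (elim oddE)
  have "h > 0" using h assms(4) by auto
  have "x ^ n + 1 = x * (x ^ h)\<^sup>2 + 1" by (simp add: h power_mult [symmetric] mult.commute)
  then have "(x + 1) * y\<^sup>2 = x * (x ^ h)\<^sup>2 + 1" using assms(5) y by simp
  then have "int ((x + 1) * y\<^sup>2) = int (x * (x ^ h)\<^sup>2 + 1)" by (rule arg_cong)
  then have "(int x + 1) * (int y)\<^sup>2 = int x * (int (x ^ h))\<^sup>2 + 1" by (simp add: algebra_simps)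
  moreover have "y > 0" using assms(5) y by (cases y) auto
  ultimately have "odd (int (x ^ h))" using assms(1,2) pell_descent_odd[of "int x" "int y" "int (x ^ h)"] by simp
  then show False using assms(1) \<open>h > 0\<close> by simp
qed

text \<open>For positive \<open>n\<close> these are the primes of the squarefree part; for
  \<open>n = 0\<close> the set is empty, since multiplicities in 0 are 0 by convention.\<close>

definition odd_mult_primes :: "nat \<Rightarrow> nat set" where
  "odd_mult_primes n = {p. prime p \<and> odd (multiplicity p n)}"

lemma odd_mult_primes_subset: "odd_mult_primes n \<subseteq> prime_factors n"
proof
  fix p assume "p \<in> odd_mult_primes n"
  then have "prime p" "multiplicity p n \<noteq> 0" by (auto simp: odd_mult_primes_def intro: odd_pos)
  then show "p \<in> prime_factors n" by (auto simp: prime_factors_multiplicity)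
qed

lemma finite_odd_mult_primes: "finite (odd_mult_primes n)"
  using finite_subset[OF odd_mult_primes_subset] by blast

lemma odd_mult_primes_nonempty: "n > 0 \<Longrightarrow> \<not> is_square n \<Longrightarrow> odd_mult_primes n \<noteq> {}"
  unfolding odd_mult_primes_def by (subst (asm) is_nth_power_conv_multiplicity_nat) auto

lemma multiplicity_mult_not_dvd:
  assumes "prime (p :: nat)" "\<not> p dvd n" "m > 0" "n > 0"
  shows "multiplicity p (m * n) = multiplicity p m"
  using assms by (subst prime_elem_multiplicity_mult_distrib) (auto simp: not_dvd_imp_multiplicity_0)

lemma odd_mult_primes_mult_coprime:
  assumes "coprime m n" "m > 0" "n > 0"
  shows "odd_mult_primes (m * n) = odd_mult_primes m \<union> odd_mult_primes n" "odd_mult_primes m \<inter> odd_mult_primes n = {}"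
proof -
  have *: "multiplicity p m = 0 \<or> multiplicity p n = 0" if "prime p" for p
    using assms that by (metis coprime_common_divisor not_dvd_imp_multiplicity_0 not_prime_unit)
  have "p \<notin> odd_mult_primes n" if "p \<in> odd_mult_primes m" for p
    using *[of p] that by (auto simp: odd_mult_primes_def)
  then show "odd_mult_primes m \<inter> odd_mult_primes n = {}" by blast
  have "p \<in> odd_mult_primes (m * n) \<longleftrightarrow> p \<in> odd_mult_primes m \<or> p \<in> odd_mult_primes n" for p
  proof (cases "prime p")
    case True
    then have "multiplicity p (m * n) = multiplicity p m + multiplicity p n"
      using assms by (intro prime_elem_multiplicity_mult_distrib) auto
    with *[OF True] show ?thesis by (auto simp: odd_mult_primes_def)
  qed (auto simp: odd_mult_primes_def)
  then show "odd_mult_primes (m * n) = odd_mult_primes m \<union> odd_mult_primes n" by blast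
qed

lemma card_odd_mult_primes_mult_coprime:
  assumes "coprime m n" "m > 0" "n > 0"
  shows "card (odd_mult_primes (m * n)) = card (odd_mult_primes m) + card (odd_mult_primes n)"
  using odd_mult_primes_mult_coprime[OF assms] by (simp add: card_Un_disjoint finite_odd_mult_primes)

text \<open>The order of \<open>A\<close> modulo \<open>l\<close> divides both \<open>2 * W\<close>
  and \<open>l - 1\<close>. A prime of \<open>W\<close> dividing \<open>l - 1\<close> would be
  smaller than \<open>l\<close>, so the order divides 2 and \<open>A\<close> is 1 or -1 modulo
  \<open>l\<close>; the value 1 would give \<open>l dvd 2\<close>.\<close>

lemma prime_dvd_power_plus_one_imp:
  fixes A W l :: nat
  assumes "prime l" "odd l" "odd W" "\<And>p. prime p \<Longrightarrow> p dvd W \<Longrightarrow> l \<le> p" "l dvd A ^ W + 1"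
  shows "l dvd A + 1"
proof -
  have "W > 0" using assms(3) by (cases W) auto
  have l2: "l > 2" using assms(1,2) by (metis prime_ge_2_nat le_neq_implies_less even_numeral)
  have m1: "[int A ^ W = -1] (mod int l)"
    using assms(5) by (simp add: cong_iff_dvd_diff) (metis of_nat_Suc of_nat_dvd_iff of_nat_power add.commute)
  have "\<not> l dvd A"
  proof
    assume "l dvd A"
    then have "l dvd A ^ W" using \<open>W > 0\<close> by (meson dvd_power dvd_trans)
    then have "l dvd 1" using assms(5) by (metis dvd_add_right_iff)
    then show False using assms(1) by simp
  qed
  then have cop: "coprime l A" using assms(1) by (simp add: prime_imp_coprime)
  have "[int A ^ (W * 2) = (-1) ^ 2] (mod int l)" unfolding power_mult by (intro cong_pow m1)
  then have "[A ^ (W * 2) = 1] (mod l)" by (metis cong_int_iff of_nat_power of_nat_1 power_minus1_even mult_1_right one_power2 power2_minus)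
  then have o1: "ord l A dvd W * 2" by (simp only: ord_divides)
  have o2: "ord l A dvd l - 1" using order_divides_totient[OF cop] assms(1) by (simp add: totient_prime)
  have "coprime (l - 1) W"
  proof (rule ccontr)
    assume "\<not> coprime (l - 1) W"
    then obtain p where p: "prime p" "p dvd l - 1" "p dvd W" by (metis coprime_iff_gcd_eq_1 gcd_greatest_iff prime_factor_nat)
    then have "p \<le> l - 1" using l2 by (intro dvd_imp_le) auto
    with assms(4)[OF p(1,3)] l2 show False by auto
  qed
  then have "ord l A dvd 2" using o1 o2 by (meson coprime_dvd_mult_right_iff coprime_divisors dvd_refl)
  then have "[A ^ 2 = 1] (mod l)" by (simp only: ord_divides)
  then have "int l dvd (int A) ^ 2 - 1" by (metis cong_iff_dvd_diff cong_int_iff of_nat_power of_nat_1)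
  then have "int l dvd (int A - 1) * (int A + 1)" by (simp add: power2_eq_square algebra_simps)
  then consider "int l dvd int A - 1" | "int l dvd int A + 1" using assms(1) prime_dvd_mult_iff prime_int_nat_transfer by (metis prime_nat_int_transfer)
  then show ?thesis
  proof cases
    case 1
    then have "[int A ^ W = 1 ^ W] (mod int l)" by (intro cong_pow) (simp add: cong_iff_dvd_diff)
    with m1 have "[(1::int) = -1] (mod int l)" by (metis cong_sym cong_trans power_one)
    then have "int l dvd 2" by (simp add: cong_iff_dvd_diff)
    then have "int l \<le> 2" by (rule zdvd_imp_le) simp
    then show ?thesis using l2 by simp
  next
    case 2
    then have "int l dvd int (A + 1)" by (simp add: add.commute)
    then show ?thesis by (simp only: of_nat_dvd_iff)
  qed
qed

text \<open>Induction removes the smallest prime \<open>l\<close> of \<open>W\<close>. The cofactor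
  \<open>Q\<close> of \<open>x + 1\<close> in \<open>x ^ l + 1\<close> is coprime to
  \<open>x + 1\<close> and not a square, so it supplies a new prime of odd multiplicity. The extra 1
  comes from \<open>A + 1\<close> itself.\<close>

lemma card_odd_mult_primes_power_plus_one_ge:
  fixes A W :: nat
  assumes "even A" "A > 0" "odd W" "\<And>p. prime p \<Longrightarrow> p dvd W \<Longrightarrow> \<not> p dvd A + 1"
  shows "card (prime_factors W) + (if is_square (A + 1) then 0 else 1) \<le> card (odd_mult_primes (A ^ W + 1))"
  using assms(3,4)
proof (induction W rule: less_induct)
  case (less W)
  have "W > 0" using less.prems(1) by (cases W) auto
  show ?case
  proof (cases "W = 1")
    case True
    have "odd_mult_primes (A + 1) \<noteq> {}" if "\<not> is_square (A + 1)" using that by (intro odd_mult_primes_nonempty) auto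
    then show ?thesis using True finite_odd_mult_primes[of "A + 1"] by (auto simp: Suc_le_eq card_gt_0_iff)
  next
    case False
    \<comment> \<open>The order of \<open>A\<close> modulo the smallest prime \<open>l\<close> of \<open>W\<close> cannot involve primes of \<open>W\<close>, so
      \<open>l\<close> does not divide \<open>A ^ (W div l) + 1\<close>.\<close>
    define l where "l = Min (prime_factors W)"
    have ne: "prime_factors W \<noteq> {}" using False \<open>W > 0\<close> by (simp add: prime_factorization_empty_iff)
    then have "l \<in> prime_factors W" unfolding l_def by (intro Min_in) auto
    then have l: "prime l" "l dvd W" by auto
    have lmin: "l \<le> p" if "prime p" "p dvd W" for p
      unfolding l_def using that \<open>W > 0\<close> by (intro Min_le) (auto simp: prime_factors_dvd)
    obtain V where V: "W = V * l" using l(2) by (metis dvdE mult.commute)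
    have "odd V" "odd l" "V > 0" using less.prems(1) V \<open>W > 0\<close> by auto
    have "l > 1" using l(1) prime_gt_1_nat by blast
    define x where "x = A ^ V"
    have x: "even x" "x > 0" using assms \<open>V > 0\<close> by (auto simp: x_def)
    have N: "A ^ W + 1 = x ^ l + 1" by (simp add: V x_def power_mult)
    obtain Q where Q: "x ^ l + 1 = (x + 1) * Q" "[Q = l] (mod (x + 1))"
      using odd_power_plus_one_factor[OF \<open>odd l\<close>] by blast
    have "Q > 0" using Q(1) by (cases Q) auto
    have "\<not> l dvd x + 1"
    proof
      assume "l dvd x + 1"
      have "l \<le> p" if "prime p" "p dvd V" for p
        using lmin[OF that(1)] that(2) V by (metis dvd_mult2)
      then have "l dvd A + 1"
        using \<open>l dvd x + 1\<close> unfolding x_def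
        by (rule prime_dvd_power_plus_one_imp[OF l(1) \<open>odd l\<close> \<open>odd V\<close>])
      with less.prems(2) l show False by blast
    qed
    then have "coprime l (x + 1)" using l(1) by (simp add: prime_imp_coprime)
    then have "coprime Q (x + 1)" using cong_imp_coprime[OF cong_sym[OF Q(2)]] by blast
    then have cop: "coprime (x + 1) Q" by (simp add: coprime_commute)
    have "odd_mult_primes Q \<noteq> {}"
      using odd_power_plus_one_quotient_not_square[OF x \<open>odd l\<close> \<open>l > 1\<close> Q(1)] \<open>Q > 0\<close> odd_mult_primes_nonempty by blast
    then have c1: "card (odd_mult_primes Q) \<ge> 1" by (simp add: Suc_le_eq card_gt_0_iff finite_odd_mult_primes)
    have "card (prime_factors V) + (if is_square (A + 1) then 0 else 1) \<le> card (odd_mult_primes (x + 1))"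
      unfolding x_def
    proof (rule less.IH)
      show "V < W" using V \<open>V > 0\<close> \<open>l > 1\<close> by simp
      show "odd V" by fact
      show "\<not> p dvd A + 1" if "prime p" "p dvd V" for p using less.prems(2)[of p] that by (simp add: V)
    qed
    moreover have "card (prime_factors W) \<le> card (prime_factors V) + 1"
    proof -
      have "prime_factors W = insert l (prime_factors V)"
        using \<open>V > 0\<close> l(1) \<open>l > 1\<close> by (auto simp: V prime_factorization_mult prime_factorization_prime)
      then show ?thesis by (simp add: card_insert_if)
    qed
    moreover have "card (odd_mult_primes (A ^ W + 1)) = card (odd_mult_primes (x + 1)) + card (odd_mult_primes Q)"
      unfolding N Q(1) by (rule card_odd_mult_primes_mult_coprime[OF cop]) (use \<open>Q > 0\<close> in auto)
    ultimately show ?thesis using c1 by linarith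
  qed
qed

lemma coprime_split_by_primes:
  fixes n :: nat
  assumes "n > 0"
  shows "\<exists>u w. n = u * w \<and> (\<forall>p. prime p \<longrightarrow> p dvd u \<longrightarrow> P p) \<and> (\<forall>p. prime p \<longrightarrow> p dvd w \<longrightarrow> \<not> P p)"
  using assms
proof (induction n rule: prime_divisors_induct)
  case (factor p n)
  then have "n > 0" by simp
  with factor.IH obtain u w where uw: "n = u * w" "\<forall>p. prime p \<longrightarrow> p dvd u \<longrightarrow> P p"
    "\<forall>p. prime p \<longrightarrow> p dvd w \<longrightarrow> \<not> P p" by blast
  show ?case
  proof (cases "P p")
    case True
    show ?thesis by (rule exI[of _ "p * u"], rule exI[of _ w])
      (use uw True factor.hyps in \<open>auto simp: prime_dvd_mult_iff dest: primes_dvd_imp_eq\<close>)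
  next
    case False
    show ?thesis by (rule exI[of _ u], rule exI[of _ "p * w"])
      (use uw False factor.hyps in \<open>auto simp: prime_dvd_mult_iff dest: primes_dvd_imp_eq\<close>)
  qed
qed auto

text \<open>\<open>d\<close> is the odd part of the order of \<open>a\<close> modulo
  \<open>p\<close>. Writing n = 2^U v, the order divides 2n but not n, which fixes its 2-part as
  exactly \<open>2 ^ (U + 1)\<close>.\<close>

lemma prime_dvd_power_plus_one_order:
  fixes a U v p :: nat
  assumes "prime p" "p \<noteq> 2" "odd v" "p dvd a ^ (2 ^ U * v) + 1"
  obtains d where "d dvd v" "2 ^ (U + 1) * d dvd p - 1" "p dvd a ^ (2 ^ U * d) + 1"
proof -
  define n where "n = 2 ^ U * v"
  have "v > 0" using assms(3) by (cases v) auto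
  then have "n > 0" by (simp add: n_def)
  have p2: "p > 2" using assms(1,2) by (metis prime_ge_2_nat le_neq_implies_less)
  have m1: "[int a ^ n = -1] (mod int p)"
    using assms(4) unfolding n_def by (simp add: cong_iff_dvd_diff) (metis of_nat_Suc of_nat_dvd_iff of_nat_power add.commute)
  have "\<not> p dvd a"
  proof
    assume "p dvd a"
    then have "p dvd a ^ n" using \<open>n > 0\<close> by (meson dvd_power dvd_trans)
    then have "p dvd 1" using assms(4) unfolding n_def by (metis dvd_add_right_iff)
    then show False using assms(1) by simp
  qed
  then have cop: "coprime p a" using assms(1) by (simp add: prime_imp_coprime)
  define r where "r = ord p a"
  have "[int a ^ (n * 2) = (-1) ^ 2] (mod int p)" unfolding power_mult by (intro cong_pow m1)
  then have "[a ^ (n * 2) = 1] (mod p)" by (metis cong_int_iff of_nat_power of_nat_1 one_power2 power2_minus)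
  then have o1: "r dvd n * 2" by (simp only: ord_divides r_def)
  have o2: "r dvd p - 1" using order_divides_totient[OF cop] assms(1) by (simp add: totient_prime r_def)
  have o3: "\<not> r dvd n"
  proof
    assume "r dvd n"
    then have "[a ^ n = 1] (mod p)" by (simp only: ord_divides r_def)
    then have "[int a ^ n = 1] (mod int p)" by (metis cong_int_iff of_nat_power of_nat_1)
    with m1 have "[(1::int) = -1] (mod int p)" by (metis cong_sym cong_trans)
    then have "int p dvd 2" by (simp add: cong_iff_dvd_diff)
    then have "int p \<le> 2" by (rule zdvd_imp_le) simp
    then show False using p2 by simp
  qed
  have "r > 0" using o1 \<open>n > 0\<close> by (intro Nat.gr0I) auto
  obtain i d where id: "r = 2 ^ i * d" "odd d"
    using \<open>r > 0\<close> multiplicity_decompose'[of r 2] by (metis less_numeral_extra(3) odd_one nat_dvd_1_iff_1 numeral_eq_one_iff semiring_norm(85))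
  have dv: "d dvd v"
  proof -
    have "d dvd 2 ^ (U + 1) * v" using o1 id(1) by (simp add: n_def mult_ac) (metis dvd_mult_right mult.commute)
    moreover have "coprime d (2 ^ (U + 1))" using id(2) by simp
    ultimately show ?thesis by (metis coprime_dvd_mult_right_iff)
  qed
  have "i \<ge> U + 1"
  proof (rule ccontr)
    assume "\<not> i \<ge> U + 1"
    then have "(2::nat) ^ i dvd 2 ^ U" by (intro le_imp_power_dvd) simp
    then have "r dvd n" unfolding id(1) n_def using dv by (rule mult_dvd_mono)
    with o3 show False by blast
  qed
  moreover have "i \<le> U + 1"
  proof -
    have "2 ^ i dvd 2 ^ (U + 1) * v" using o1 id(1) by (simp add: n_def mult_ac) (metis dvd_mult_left mult.commute)
    moreover have "coprime (2 ^ i) v" using assms(3) by simp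
    ultimately have "(2::nat) ^ i dvd 2 ^ (U + 1)" by (metis coprime_dvd_mult_left_iff)
    then show ?thesis by (metis dvd_power_iff_le le_refl)
  qed
  ultimately have r: "r = 2 ^ (U + 1) * d" using id(1) by (metis le_antisym)
  have "p dvd a ^ (2 ^ U * d) + 1"
  proof -
    have "[a ^ (2 ^ U * d * 2) = 1] (mod p)" unfolding ord_divides r_def[symmetric] r by (simp add: mult_ac)
    then have "[(int a ^ (2 ^ U * d)) ^ 2 = 1] (mod int p)" 
      by (metis cong_int_iff of_nat_power of_nat_1 power_mult)
    then have "int p dvd (int a ^ (2 ^ U * d) - 1) * (int a ^ (2 ^ U * d) + 1)"
      by (simp add: cong_iff_dvd_diff power2_eq_square algebra_simps)
    then consider "int p dvd int a ^ (2 ^ U * d) - 1" | "int p dvd int a ^ (2 ^ U * d) + 1"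
      using assms(1) by (metis prime_dvd_mult_iff prime_nat_int_transfer)
    then show ?thesis
    proof cases
      case 1
      then have "[int a ^ (2 ^ U * d) = 1] (mod int p)" by (simp add: cong_iff_dvd_diff)
      then have "[a ^ (2 ^ U * d) = 1] (mod p)" by (metis cong_int_iff of_nat_power of_nat_1)
      then have "r dvd 2 ^ U * d" by (simp only: ord_divides r_def)
      then have "r dvd n" unfolding n_def by (rule dvd_trans) (simp add: dv)
      with o3 show ?thesis by blast
    next
      case 2
      then have "int p dvd int (a ^ (2 ^ U * d) + 1)" by (simp add: add.commute)
      then show ?thesis by (simp only: of_nat_dvd_iff)
    qed
  qed
  with that dv o2 r show thesis by metis
qed

subsection \<open>Sums over divisors\<close>

lemma sum_divisors_mult_coprime:
  fixes f :: "nat \<Rightarrow> 'a::comm_monoid_add"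
  assumes "coprime m n"
  shows "(\<Sum>d | d dvd m * n. f d) = (\<Sum>x | x dvd m. \<Sum>y | y dvd n. f (x * y))"
proof -
  have "bij_betw (\<lambda>(x, y). x * y) ({x. x dvd m} \<times> {y. y dvd n}) {d. d dvd m * n}"
  proof (rule bij_betwI[where g = "\<lambda>d. (gcd d m, gcd d n)"])
    have gcds: "gcd (x * y) m = x" "gcd (x * y) n = y" if "x dvd m" "y dvd n" for x y
    proof -
      have "coprime m y" "coprime n x" using assms that by (meson coprime_commute coprime_divisors dvd_refl)+
      then have "gcd (x * y) m = gcd x m" "gcd (x * y) n = gcd y n"
        by (simp_all add: gcd_mult_left_right_cancel gcd_mult_left_left_cancel)
      then show "gcd (x * y) m = x" "gcd (x * y) n = y" using that by (simp_all add: gcd_nat.absorb1)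
    qed
    then show "(\<lambda>d. (gcd d m, gcd d n)) ((\<lambda>(x, y). x * y) z) = z"
      if "z \<in> {x. x dvd m} \<times> {y. y dvd n}" for z
      using that by auto
    show "(\<lambda>(x, y). x * y) ((\<lambda>d. (gcd d m, gcd d n)) d) = d" if "d \<in> {d. d dvd m * n}" for d
      using that division_decomp[of d m n] gcds by auto
  qed (auto intro: mult_dvd_mono)
  then show ?thesis
    by (simp add: sum.cartesian_product sum.reindex_bij_betw[symmetric] case_prod_unfold)
qed

lemma divisors_prime_power:
  assumes "prime (p :: nat)"
  shows "(\<Sum>d | d dvd p ^ e. f d) = (\<Sum>i\<le>e. f (p ^ i))"
proof -
  have "{d. d dvd p ^ e} = (\<lambda>i. p ^ i) ` {..e}"
    using assms by (auto simp: divides_primepow_nat)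
  moreover have "inj_on (\<lambda>i. p ^ i) {..e}"
    using prime_gt_1_nat[OF assms] by (auto intro: inj_onI)
  ultimately show ?thesis by (simp add: sum.reindex)
qed

lemma prime_power_decompose:
  assumes "n > 0" "prime (p :: nat)"
  obtains m where "n = p ^ multiplicity p n * m" "\<not> p dvd m" "m > 0"
  using multiplicity_decompose'[of n p] assms by (metis mult_0_right not_gr_zero not_prime_unit)

lemma prime_power_coprime_induct [consumes 1, case_names one mult]:
  assumes "n > 0"
  assumes "P 1"
  assumes "\<And>p e m. prime (p :: nat) \<Longrightarrow> e > 0 \<Longrightarrow> \<not> p dvd m \<Longrightarrow> m > 0 \<Longrightarrow> P m \<Longrightarrow> P (p ^ e * m)"
  shows "P n"
  using assms(1)
proof (induction n rule: less_induct)
  case (less n)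
  show ?case
  proof (cases "n = 1")
    case False
    then obtain p where p: "prime p" "p dvd n" using prime_factor_nat by blast
    obtain m where m: "n = p ^ multiplicity p n * m" "\<not> p dvd m" "m > 0"
      using prime_power_decompose[OF less.prems p(1)] .
    have e: "multiplicity p n > 0" using p less.prems by (simp add: prime_multiplicity_gt_zero_iff)
    have "1 < p ^ multiplicity p n" using e prime_gt_1_nat[OF p(1)] by (rule one_less_power[rotated])
    then have "m < n" using m(1,3) by (metis mult_1 mult_less_cancel2)
    from assms(3)[OF p(1) e m(2,3) less.IH[OF this m(3)]] m(1) show ?thesis by simp
  qed (use assms(2) in simp)
qed

section \<open>Multiplicativity of sigma and Euler's form of odd \<open>(4 * m + 2)\<close>-perfect
  numbers\<close>

lemma sigma_mult_coprime: "coprime m n \<Longrightarrow> sigma (m * n) = sigma m * sigma n"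
  by (simp add: sigma_def sum_divisors_mult_coprime sum_product)

lemma sigma_prime_power: "prime p \<Longrightarrow> sigma (p ^ e) = (\<Sum>i\<le>e. p ^ i)"
  by (simp add: sigma_def divisors_prime_power)

lemma sum_powers_odd_exponent:
  fixes p :: nat
  shows "(\<Sum>i\<le>2 * k + 1. p ^ i) = (p + 1) * (\<Sum>i\<le>k. p ^ (2 * i))"
  by (induction k) (simp_all add: algebra_simps)

lemma Suc_dvd_sigma_odd_prime_power:
  assumes "prime p" "odd e"
  shows "p + 1 dvd sigma (p ^ e)"
  using assms by (elim oddE) (simp only: sigma_prime_power sum_powers_odd_exponent dvd_triv_left)

lemma odd_mult_primes_decompose:
  assumes "p \<in> odd_mult_primes n"
  obtains e m where "n = p ^ e * m" "odd e" "\<not> p dvd m" "m > 0" "prime p"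
proof -
  have "n \<noteq> 0" using assms by (cases "n = 0") (auto simp: odd_mult_primes_def)
  then show thesis
    using that prime_power_decompose[of n p] assms by (metis (mono_tags, lifting) mem_Collect_eq not_gr_zero odd_mult_primes_def)
qed

lemma Suc_dvd_sigma_odd_mult_primes:
  assumes "p \<in> odd_mult_primes n"
  shows "p + 1 dvd sigma n"
proof -
  obtain e m where em: "n = p ^ e * m" "odd e" "\<not> p dvd m" "prime p" using odd_mult_primes_decompose[OF assms] by metis
  have "coprime (p ^ e) m" using em by (simp add: prime_imp_coprime)
  then show ?thesis using Suc_dvd_sigma_odd_prime_power[OF em(4,2)] by (simp add: em(1) sigma_mult_coprime)
qed

text \<open>For odd \<open>n\<close> the hypothesis makes \<open>sigma n\<close> equal to 2 modulo
  4. Each prime \<open>p\<close> of odd multiplicity contributes the even divisor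
  \<open>p + 1\<close>, so two such primes, or a single one that is 3 modulo 4, would make
  \<open>sigma n\<close> divisible by 4.\<close>

lemma euler_form:
  assumes "odd n" "sigma n = (4 * m + 2) * n"
  shows "card (odd_mult_primes n) \<le> 1" "\<And>p. p \<in> odd_mult_primes n \<Longrightarrow> [p = 1] (mod 4)"
proof -
  have not4: "\<not> 4 dvd sigma n"
  proof
    assume "4 dvd sigma n"
    then have "2 * 2 dvd 2 * ((2 * m + 1) * n)" unfolding assms(2) by (simp add: algebra_simps)
    then have "2 dvd (2 * m + 1) * n" by (subst (asm) nat_mult_dvd_cancel1) auto
    then show False using assms(1) by simp
  qed
  have odd: "odd p" if "p \<in> odd_mult_primes n" for p
    using odd_mult_primes_subset that assms(1) by (metis dvd_trans in_prime_factors_iff subsetD)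
  have "p = r" if p: "p \<in> odd_mult_primes n" and r: "r \<in> odd_mult_primes n" for p r
  proof (rule ccontr)
    assume "p \<noteq> r"
    \<comment> \<open>Splitting off the \<open>p\<close>-part places \<open>p + 1\<close> and
      \<open>r + 1\<close> in different factors of \<open>sigma n\<close>, so their product divides
      it even if they share a factor.\<close>
    obtain e k where em: "n = p ^ e * k" "odd e" "\<not> p dvd k" "k > 0" "prime p" using odd_mult_primes_decompose[OF p] .
    have "prime r" using r by (simp add: odd_mult_primes_def)
    then have "\<not> r dvd p ^ e" using \<open>p \<noteq> r\<close> em(5) by (metis prime_dvd_power primes_dvd_imp_eq)
    then have "multiplicity r n = multiplicity r k"
      using multiplicity_mult_not_dvd[of r "p ^ e" k] \<open>prime r\<close> em by (simp add: mult.commute prime_gt_0_nat)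
    then have "r \<in> odd_mult_primes k" using r by (simp add: odd_mult_primes_def)
    then have "r + 1 dvd sigma k" by (rule Suc_dvd_sigma_odd_mult_primes)
    moreover have "p + 1 dvd sigma (p ^ e)" using em by (intro Suc_dvd_sigma_odd_prime_power)
    moreover have "coprime (p ^ e) k" using em by (simp add: prime_imp_coprime)
    ultimately have "(p + 1) * (r + 1) dvd sigma n" unfolding em(1) by (simp only: sigma_mult_coprime mult_dvd_mono)
    moreover have "2 * 2 dvd (p + 1) * (r + 1)" using odd[OF p] odd[OF r] by (intro mult_dvd_mono) auto
    ultimately have "4 dvd sigma n" by (metis dvd_trans mult_2 numeral_Bit0)
    with not4 show False by blast
  qed
  then show "card (odd_mult_primes n) \<le> 1" using finite_odd_mult_primes[of n] by (metis One_nat_def card_le_Suc0_iff_eq)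
  show "[p = 1] (mod 4)" if p: "p \<in> odd_mult_primes n" for p
  proof -
    have "p mod 4 = 1 \<or> p mod 4 = 3" using odd[OF p] by presburger
    moreover have "p mod 4 \<noteq> 3"
    proof
      assume "p mod 4 = 3"
      then have "4 dvd p + 1" by presburger
      then show False using Suc_dvd_sigma_odd_mult_primes[OF p] not4 dvd_trans by blast
    qed
    ultimately show ?thesis by (simp add: cong_def)
  qed
qed

section \<open>Abundancy as a sum of reciprocals, and its log-weighted analogue\<close>

lemma sum_inverse_divisors:
  assumes "n > 0"
  shows "(\<Sum>d | d dvd n. 1 / real d) = real (sigma n) / real n"
proof -
  have "(\<Sum>d | d dvd n. 1 / real d) = (\<Sum>d | d dvd n. real d / real n)"
    using assms by (intro sum.reindex_bij_witness[of _ "\<lambda>d. n div d" "\<lambda>d. n div d"])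
      (auto simp: real_of_nat_div)
  then show ?thesis by (simp add: sigma_def sum_divide_distrib)
qed

lemma sum_inverse_divisors_mult_coprime:
  "coprime m n \<Longrightarrow> (\<Sum>d | d dvd m * n. 1 / real d) = (\<Sum>d | d dvd m. 1 / real d) * (\<Sum>d | d dvd n. 1 / real d)"
  by (simp add: sum_divisors_mult_coprime sum_product)

lemma prime_factors_prime_power_mult:
  assumes "prime (p :: nat)" "e > 0" "m > 0"
  shows "prime_factors (p ^ e * m) = insert p (prime_factors m)"
  using assms by (auto simp: prime_factors_dvd prime_dvd_mult_iff prime_dvd_power_iff primes_dvd_imp_eq)

lemma sum_inverse_divisors_pos: "n > 0 \<Longrightarrow> (\<Sum>d | d dvd n. 1 / real d) > 0"
  by (intro sum_pos) (auto simp: dvd_pos_nat)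

text \<open>The local factor at \<open>p\<close> is a truncated geometric series below 1 + 1/(p-1),
  and ln(1 + x) is at most x. The weak form also covers \<open>n = 1\<close>, so that one induction
  serves both claims.\<close>

lemma ln_sum_inverse_divisors:
  assumes "n > 0"
  shows "ln (\<Sum>d | d dvd n. 1 / real d) \<le> (\<Sum>p\<in>prime_factors n. 1 / (real p - 1)) \<and>
    (n > 1 \<longrightarrow> ln (\<Sum>d | d dvd n. 1 / real d) < (\<Sum>p\<in>prime_factors n. 1 / (real p - 1)))"
  using assms
proof (induction n rule: prime_power_coprime_induct)
  case one
  then show ?case by simp
next
  case (mult p e m)
  have p: "real p > 1" using prime_gt_1_nat[OF mult(1)] by simp
  have notin: "p \<notin> prime_factors m" using mult(3) by auto
  have "(\<Sum>d | d dvd p ^ e. 1 / real d) = (\<Sum>i\<le>e. (1 / real p) ^ i)"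
    using mult(1) by (simp add: divisors_prime_power power_one_over)
  also have "\<dots> = (1 - (1 / real p) ^ (e + 1)) / (1 - 1 / real p)"
    using p by (subst sum_gp0) auto
  also have "\<dots> < 1 / (1 - 1 / real p)"
    using p by (intro divide_strict_right_mono) auto
  also have "\<dots> = 1 + 1 / (real p - 1)" using p by (simp add: field_simps)
  finally have lt: "(\<Sum>d | d dvd p ^ e. 1 / real d) < 1 + 1 / (real p - 1)" .
  have pos: "(\<Sum>d | d dvd p ^ e. 1 / real d) > 0"
    using mult(1) by (intro sum_inverse_divisors_pos) (simp add: prime_gt_0_nat)
  have "ln (\<Sum>d | d dvd p ^ e. 1 / real d) < ln (1 + 1 / (real p - 1))"
    using lt pos p by (subst ln_less_cancel_iff) auto
  also have "\<dots> \<le> 1 / (real p - 1)" using p by (intro ln_add_one_self_le_self) simp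
  finally have *: "ln (\<Sum>d | d dvd p ^ e. 1 / real d) < 1 / (real p - 1)" .
  have "coprime (p ^ e) m" using mult by (simp add: prime_imp_coprime)
  then have "ln (\<Sum>d | d dvd p ^ e * m. 1 / real d)
      = ln (\<Sum>d | d dvd p ^ e. 1 / real d) + ln (\<Sum>d | d dvd m. 1 / real d)"
    using pos sum_inverse_divisors_pos[OF mult(4)]
    by (simp only: sum_inverse_divisors_mult_coprime ln_mult_pos)
  moreover have "(\<Sum>q\<in>prime_factors (p ^ e * m). 1 / (real q - 1))
      = 1 / (real p - 1) + (\<Sum>q\<in>prime_factors m. 1 / (real q - 1))"
    using mult notin by (simp add: prime_factors_prime_power_mult)
  ultimately show ?case using * mult.IH by simp
qed

text \<open>A product rule: weighting by the logarithm acts as a derivation because ln(xy) = ln x +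
  ln y.\<close>

lemma sum_ln_divisors_mult_coprime:
  assumes "coprime m n" "m > 0" "n > 0"
  shows "(\<Sum>d | d dvd m * n. ln (real d) / real d)
    = (\<Sum>d | d dvd m. ln (real d) / real d) * (\<Sum>d | d dvd n. 1 / real d)
      + (\<Sum>d | d dvd m. 1 / real d) * (\<Sum>d | d dvd n. ln (real d) / real d)"
proof -
  have "(\<Sum>d | d dvd m * n. ln (real d) / real d)
      = (\<Sum>x | x dvd m. \<Sum>y | y dvd n. ln (real x) / real x * (1 / real y) + 1 / real x * (ln (real y) / real y))"
    unfolding sum_divisors_mult_coprime[OF assms(1)]
  proof (intro sum.cong refl)
    fix x y assume "x \<in> {x. x dvd m}" "y \<in> {y. y dvd n}"
    then have "x > 0" "y > 0" using assms dvd_pos_nat by auto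
    then show "ln (real (x * y)) / real (x * y)
        = ln (real x) / real x * (1 / real y) + 1 / real x * (ln (real y) / real y)"
      by (simp add: ln_mult field_simps)
  qed
  then show ?thesis by (simp only: sum.distrib sum_product)
qed

text \<open>For the infinite series this is an equality, both sides being x/(1-x)^2. The truncated
  inequality follows from S(e+1) = x (S(e) + G(e)), where S is the weighted and G the plain
  sum.\<close>

lemma sum_index_geometric_le:
  fixes x :: real
  assumes "0 \<le> x" "x < 1"
  shows "(\<Sum>i\<le>e. real i * x ^ i) \<le> x / (1 - x) * (\<Sum>i\<le>e. x ^ i)"
proof (induction e)
  case (Suc e)
  have "(\<Sum>i\<le>Suc e. real i * x ^ i) = (\<Sum>i\<le>e. real (Suc i) * x ^ Suc i)"
    by (subst sum.atMost_Suc_shift) simp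
  also have "\<dots> = x * ((\<Sum>i\<le>e. real i * x ^ i) + (\<Sum>i\<le>e. x ^ i))"
    by (simp add: sum_distrib_left sum.distrib[symmetric] algebra_simps)
  also have "\<dots> \<le> x * (x / (1 - x) * (\<Sum>i\<le>e. x ^ i) + (\<Sum>i\<le>e. x ^ i))"
    using Suc assms by (intro mult_left_mono add_right_mono)
  also have "\<dots> = x / (1 - x) * (\<Sum>i\<le>e. x ^ i)" using assms by (simp add: field_simps)
  also have "\<dots> \<le> x / (1 - x) * (\<Sum>i\<le>Suc e. x ^ i)" using assms by (intro mult_left_mono) auto
  finally show ?case .
qed (use assms in simp)

text \<open>By the product rule the ratio of the two divisor sums is additive over coprime factors;
  for a prime power, x = 1/p in \<open>sum_index_geometric_le\<close> bounds it by ln p /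
  (p-1).\<close>

lemma sum_ln_divisors_le:
  assumes "n > 0"
  shows "(\<Sum>d | d dvd n. ln (real d) / real d)
    \<le> (\<Sum>d | d dvd n. 1 / real d) * (\<Sum>p\<in>prime_factors n. ln (real p) / (real p - 1))"
  using assms
proof (induction n rule: prime_power_coprime_induct)
  case one
  then show ?case by simp
next
  case (mult p e m)
  have p: "real p > 1" using prime_gt_1_nat[OF mult(1)] by simp
  have notin: "p \<notin> prime_factors m" using mult(3) by auto
  let ?H = "\<lambda>n. \<Sum>d | d dvd n. 1 / real d"
  let ?G = "\<lambda>n. \<Sum>d | d dvd n. ln (real d) / real d"
  have "?G (p ^ e) = ln (real p) * (\<Sum>i\<le>e. real i * (1 / real p) ^ i)"
    using mult(1) p by (simp add: divisors_prime_power power_one_over ln_realpow sum_distrib_left mult_ac)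
  also have "\<dots> \<le> ln (real p) * ((1 / real p) / (1 - 1 / real p) * (\<Sum>i\<le>e. (1 / real p) ^ i))"
    using p by (intro mult_left_mono sum_index_geometric_le) auto
  also have "\<dots> = ?H (p ^ e) * (ln (real p) / (real p - 1))"
    using p mult(1) by (simp add: divisors_prime_power power_one_over field_simps)
  finally have G: "?G (p ^ e) \<le> ?H (p ^ e) * (ln (real p) / (real p - 1))" .
  have cop: "coprime (p ^ e) m" using mult by (simp add: prime_imp_coprime)
  have pe: "p ^ e > 0" using p by simp
  have "?G (p ^ e * m) = ?G (p ^ e) * ?H m + ?H (p ^ e) * ?G m"
    by (rule sum_ln_divisors_mult_coprime[OF cop pe mult(4)])
  also have "\<dots> \<le> (?H (p ^ e) * (ln (real p) / (real p - 1))) * ?H m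
      + ?H (p ^ e) * (?H m * (\<Sum>q\<in>prime_factors m. ln (real q) / (real q - 1)))"
    using G mult.IH sum_inverse_divisors_pos[OF pe] sum_inverse_divisors_pos[OF mult(4)]
    by (intro add_mono mult_left_mono mult_right_mono) auto
  also have "\<dots> = ?H (p ^ e) * ?H m * (ln (real p) / (real p - 1) + (\<Sum>q\<in>prime_factors m. ln (real q) / (real q - 1)))"
    by (simp only: algebra_simps)
  also have "\<dots> = ?H (p ^ e * m) * (\<Sum>q\<in>prime_factors (p ^ e * m). ln (real q) / (real q - 1))"
    using mult notin by (simp add: prime_factors_prime_power_mult sum_inverse_divisors_mult_coprime[OF cop])
  finally show ?case .
qed

subsection \<open>The abundancy of \<open>a ^ n + 1\<close>\<close>

text \<open>The i-th smallest element of a set of positive integers is at least i; the induction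
  removes the maximum.\<close>

lemma sum_le_sum_initial_segment:
  fixes f :: "nat \<Rightarrow> real"
  assumes "finite X" "0 \<notin> X" "\<And>i j. 0 < i \<Longrightarrow> i \<le> j \<Longrightarrow> f j \<le> f i"
  shows "sum f X \<le> (\<Sum>i=1..card X. f i)"
  using assms(1,2)
proof (induction "card X" arbitrary: X)
  case 0
  then show ?case by simp
next
  case (Suc k)
  define x where "x = Max X"
  have "X \<noteq> {}" using Suc.hyps(2) by auto
  then have x: "x \<in> X" using Suc.prems by (simp add: x_def)
  have "X \<subseteq> {1..x}" using Suc.prems by (auto simp: x_def Suc_le_eq intro: gr0I)
  then have le: "Suc k \<le> x" using card_mono[of "{1..x}" X] Suc.hyps(2) by simp
  have card: "k = card (X - {x})" using Suc.hyps(2) x by simp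
  have "sum f (X - {x}) \<le> sum f {1..k}"
    using Suc.hyps(1)[OF card] Suc.prems card by simp
  have "sum f X = f x + sum f (X - {x})" using x Suc.prems by (simp add: sum.remove)
  also have "\<dots> \<le> f (Suc k) + (\<Sum>i=1..k. f i)"
    using \<open>sum f (X - {x}) \<le> sum f {1..k}\<close> le assms(3)[of "Suc k" x]
    by (intro add_mono) auto
  finally have "sum f X \<le> sum f {1..Suc k}" by simp
  then show ?case by (simp only: Suc.hyps(2))
qed

text \<open>The numbers \<open>p - 1\<close> are distinct positive multiples of \<open>m\<close>, so
  the extreme case is m, 2m, 3m and so on.\<close>

lemma sum_residue_class_one_le:
  fixes g :: "nat \<Rightarrow> real"
  assumes "finite P" "m > 0" "\<And>p. p \<in> P \<Longrightarrow> p > 1 \<and> m dvd p - 1"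
    "\<And>i j. 0 < i \<Longrightarrow> i \<le> j \<Longrightarrow> g j \<le> g i"
  shows "(\<Sum>p\<in>P. g (p - 1)) \<le> (\<Sum>i=1..card P. g (m * i))"
proof -
  define h where "h = (\<lambda>p. (p - 1) div m)"
  have h: "m * h p = p - 1" if "p \<in> P" for p using assms(3)[OF that] by (simp add: h_def)
  have inj: "inj_on h P"
  proof (rule inj_onI)
    fix p r assume pr: "p \<in> P" "r \<in> P" "h p = h r"
    then have "p - 1 = r - 1" using h by metis
    then show "p = r" using assms(3) pr by (metis diff_add_inverse2 le_add_diff_inverse2 less_imp_le)
  qed
  have "(\<Sum>p\<in>P. g (p - 1)) = (\<Sum>i\<in>h ` P. g (m * i))"
    using h by (simp add: sum.reindex[OF inj] cong: sum.cong)
  also have "\<dots> \<le> (\<Sum>i=1..card (h ` P). g (m * i))"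
  proof (rule sum_le_sum_initial_segment)
    show "0 \<notin> h ` P"
    proof
      assume "0 \<in> h ` P"
      then obtain p where "p \<in> P" "h p = 0" by auto
      with h[of p] assms(3)[of p] show False by auto
    qed
  qed (use assms in auto)
  finally show ?thesis by (simp add: card_image[OF inj])
qed

lemma harm_le_Suc_ln:
  assumes "n > 0"
  shows "(\<Sum>i=1..n. 1 / real i) \<le> 1 + ln (real n)"
proof -
  obtain k where n: "n = Suc k" using assms by (cases n) auto
  have "harm (Suc k) - ln (real (Suc k)) \<le> harm (Suc 0) - ln (real (Suc 0))"
    using decseqD[OF decseq_harm_diff_ln, of 0 k] by simp
  then show ?thesis by (simp add: n harm_def inverse_eq_divide)
qed

lemma prod_primes_dvd:
  fixes n :: nat
  assumes "finite P" "\<And>p. p \<in> P \<Longrightarrow> prime p \<and> p dvd n"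
  shows "\<Prod>P dvd n"
  using assms
proof (induction P rule: finite_induct)
  case (insert p P)
  have "coprime p (\<Prod>P)"
    using insert by (intro prod_coprime_right) (metis insertCI primes_coprime)
  then show ?case using insert by (simp add: divides_mult)
qed simp

text \<open>Each prime is at least \<open>m + 1\<close> and their product divides
  \<open>M + 1\<close>. Strictness of m^k < (m+1)^k then trades \<open>M + 1\<close> for
  \<open>M\<close>, so that logarithms give \<open>ln M\<close> exactly.\<close>

lemma power_card_prime_divisors_le:
  fixes m M :: nat
  assumes "finite P" "M > 0" "\<And>p. p \<in> P \<Longrightarrow> prime p \<and> m dvd p - 1 \<and> p dvd M + 1"
  shows "m ^ card P \<le> M"
proof (cases "P = {}")
  case False
  have "m + 1 \<le> p" if "p \<in> P" for p
    using assms(3)[OF that] prime_gt_1_nat[of p] dvd_imp_le[of m "p - 1"] by simp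
  then have "(\<Prod>p\<in>P. m + 1) \<le> \<Prod>P" by (intro prod_mono) simp
  then have "(m + 1) ^ card P \<le> \<Prod>P" by simp
  also have "\<dots> \<le> M + 1"
    by (intro dvd_imp_le prod_primes_dvd assms(1)) (use assms in auto)
  finally have "(m + 1) ^ card P \<le> M + 1" .
  moreover have "m ^ card P < (m + 1) ^ card P"
    using False assms(1) by (intro power_strict_mono) (auto simp: card_gt_0_iff)
  ultimately show ?thesis by simp
qed (use assms in simp)

lemma sum_prime_divisors_le:
  fixes m M :: nat
  assumes "finite P" "P \<noteq> {}" "m \<ge> 2" "M > 0" "\<And>p. p \<in> P \<Longrightarrow> prime p \<and> m dvd p - 1 \<and> p dvd M + 1"
  shows "(\<Sum>p\<in>P. 1 / (real p - 1)) \<le> (1 + ln (ln (real M) / ln (real m))) / real m"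
proof -
  define k where "k = card P"
  have k: "k > 0" using assms by (simp add: k_def card_gt_0_iff)
  have p1: "p > 1" if "p \<in> P" for p using assms(5)[OF that] prime_gt_1_nat by blast
  have "real (m ^ k) \<le> real M"
    unfolding k_def using power_card_prime_divisors_le[OF assms(1,4,5)] by (simp only: of_nat_le_iff)
  then have "real m ^ k \<le> real M" by simp
  then have "ln (real m ^ k) \<le> ln (real M)" using assms(3,4) by (subst ln_le_cancel_iff) auto
  then have "real k * ln (real m) \<le> ln (real M)" using assms(3) by (simp add: ln_realpow)
  then have "real k \<le> ln (real M) / ln (real m)" using assms(3) by (simp add: field_simps)
  then have lnk: "ln (real k) \<le> ln (ln (real M) / ln (real m))" using k by (intro ln_mono) auto
  have "(\<Sum>p\<in>P. 1 / (real p - 1)) = (\<Sum>p\<in>P. 1 / real (p - 1))"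
    using p1 by (intro sum.cong) (auto simp: of_nat_diff less_imp_le)
  also have "\<dots> \<le> (\<Sum>i=1..k. 1 / real (m * i))"
    unfolding k_def using assms p1 by (intro sum_residue_class_one_le[where g = "\<lambda>i. 1 / real i"]) (auto simp: frac_le)
  also have "\<dots> = (\<Sum>i=1..k. 1 / real i) / real m" by (simp add: sum_divide_distrib mult.commute)
  also have "\<dots> \<le> (1 + ln (real k)) / real m"
    using harm_le_Suc_ln[OF k] by (intro divide_right_mono) auto
  also have "\<dots> \<le> (1 + ln (ln (real M) / ln (real m))) / real m"
    using lnk by (intro divide_right_mono) auto
  finally show ?thesis .
qed


lemma ln_abundancy_less:
  fixes a U v :: nat
  assumes "even a" "a \<ge> 2" "odd v"
  defines "N \<equiv> a ^ (2 ^ U * v) + 1"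
  shows "ln (real (sigma N) / real N)
    < (\<Sum>d | d dvd v. (1 + ln (real d) + ln (2 ^ U * ln (real a)) - ln (ln (real (2 ^ (U + 1) * d)))) / real (2 ^ (U + 1) * d))"
proof -
  define L where "L = 2 ^ U * ln (real a)"
  define q where "q = (2::nat) ^ (U + 1)"
  let ?T = "\<lambda>d. (1 + ln (real d) + ln L - ln (ln (real (q * d)))) / real (q * d)"
  have "v > 0" using assms(3) by (cases v) auto
  have "N > 1" using assms(2) by (simp add: N_def)
  have "odd N" using assms(1) \<open>v > 0\<close> by (simp add: N_def)
  have lna: "ln (real a) \<ge> ln 2" using assms(2) by simp
  have L: "L > 0" using assms(2) by (simp add: L_def)
  have q: "q \<ge> 2" by (simp add: q_def)
  have "\<exists>d. d dvd v \<and> q * d dvd p - 1 \<and> p dvd a ^ (2 ^ U * d) + 1" if "p \<in> prime_factors N" for p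
  proof -
    have p: "prime p" "p dvd N" using that by auto
    then have "p \<noteq> 2" using \<open>odd N\<close> by auto
    then show ?thesis
      using prime_dvd_power_plus_one_order[OF p(1) _ assms(3), of a U] p(2) unfolding N_def q_def by blast
  qed
  \<comment> \<open>Each prime is assigned one divisor of \<open>v\<close>; the sum over primes is
    grouped along this assignment.\<close>
  then obtain \<delta> where \<delta>: "\<And>p. p \<in> prime_factors N \<Longrightarrow> \<delta> p dvd v \<and> q * \<delta> p dvd p - 1 \<and> p dvd a ^ (2 ^ U * \<delta> p) + 1"
    by metis
  have T: "(\<Sum>p\<in>{p\<in>prime_factors N. \<delta> p = d}. 1 / (real p - 1)) \<le> ?T d" if d: "d dvd v" for d
  proof -
    define P where "P = {p\<in>prime_factors N. \<delta> p = d}"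
    have "d > 0" using d \<open>v > 0\<close> by (simp add: dvd_pos_nat)
    then have m: "q * d \<ge> 2" using q by (metis One_nat_def Suc_leI mult_le_mono nat_mult_1_right)
    have "real 2 \<le> real (q * d)" using m by (simp only: of_nat_le_iff)
    then have lnm: "ln (real (q * d)) > 0" by (intro ln_gt_zero) linarith
    \<comment> \<open>Divisors to which no prime is assigned stay in the sum, so their terms must be
      nonnegative; with \<open>L\<close> = 2^U ln a this means ln(qd) is at most e d L.\<close>
    have "ln (real (q * d)) = real (U + 1) * ln 2 + ln (real d)"
      using \<open>d > 0\<close> by (simp add: q_def ln_mult ln_realpow algebra_simps)
    also have "\<dots> \<le> L + (real d - 1)"
    proof (rule add_mono)
      have "U + 1 \<le> 2 ^ U" by (induction U) auto
      then have "real (U + 1) \<le> 2 ^ U" by (metis of_nat_le_iff of_nat_numeral of_nat_power)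
      then show "real (U + 1) * ln 2 \<le> L"
        unfolding L_def using lna by (intro mult_mono) auto
      show "ln (real d) \<le> real d - 1" using \<open>d > 0\<close> by (intro ln_le_minus_one) simp
    qed
    also have "\<dots> \<le> exp 1 * (real d * L)"
    proof -
      \<comment> \<open>The bound 2.5 for e suffices because L is at least ln 2, hence at least 2/3,
        so that 1.5 L is at least 1.\<close>
      have e: "exp (1::real) \<ge> 2.5" using exp_lower_Taylor_quadratic[of "1::real"] by simp
      have "L \<ge> 1 * ln 2" unfolding L_def using lna by (intro mult_mono) auto
      then have "L \<ge> 2/3" using ln2_ge_two_thirds by simp
      then have "real d - 1 \<le> (real d - 1) * (1.5 * L)" using \<open>d > 0\<close>
        by (intro mult_le_cancel_left1[THEN iffD2]) auto
      then have "L + (real d - 1) \<le> L + (real d - 1) * (1.5 * L)" by simp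
      also have "\<dots> \<le> L + (real d - 1) * (1.5 * L) + L * (real d + 0.5)"
        by (rule add_increasing2) (use L in auto)
      also have "\<dots> = 2.5 * (real d * L)" by (simp add: field_simps)
      also have "\<dots> \<le> exp 1 * (real d * L)" using e L by (intro mult_right_mono) auto
      finally show ?thesis .
    qed
    finally have "ln (ln (real (q * d))) \<le> ln (exp 1 * (real d * L))"
      using lnm by (intro ln_mono) auto
    also have "\<dots> = 1 + (ln (real d) + ln L)" using L \<open>d > 0\<close> by (simp add: ln_mult)
    finally have nonneg: "0 \<le> ?T d" by (intro divide_nonneg_nonneg) auto
    show ?thesis
    proof (cases "P = {}")
      case True
      show ?thesis using nonneg unfolding P_def[symmetric] by (simp only: True sum.empty)
    next
      case False
      let ?M = "a ^ (2 ^ U * d)"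
      have "(\<Sum>p\<in>P. 1 / (real p - 1)) \<le> (1 + ln (ln (real ?M) / ln (real (q * d)))) / real (q * d)"
        using False m assms(2) \<delta> by (intro sum_prime_divisors_le) (auto simp: P_def)
      also have "ln (real ?M) = real d * L" using assms(2) by (simp add: ln_realpow L_def)
      also have "1 + ln (real d * L / ln (real (q * d))) = 1 + ln (real d) + ln L - ln (ln (real (q * d)))"
        using L lnm \<open>d > 0\<close> by (simp add: ln_div ln_mult)
      finally show ?thesis unfolding P_def .
    qed
  qed
  have "ln (real (sigma N) / real N) < (\<Sum>p\<in>prime_factors N. 1 / (real p - 1))"
    using ln_sum_inverse_divisors[of N] \<open>N > 1\<close> by (simp add: sum_inverse_divisors)
  also have "\<dots> = (\<Sum>d | d dvd v. \<Sum>p\<in>{p\<in>prime_factors N. \<delta> p = d}. 1 / (real p - 1))"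
    using \<delta> \<open>v > 0\<close> by (intro sum.group[symmetric]) auto
  also have "\<dots> \<le> (\<Sum>d | d dvd v. ?T d)" using T by (intro sum_mono) auto
  finally show ?thesis unfolding L_def q_def .
qed

subsection \<open>Prime factors of the exponent\<close>

text \<open>If \<open>r\<close> divides \<open>y + 1\<close> but not \<open>n\<close>, then the
  cofactor, congruent to \<open>n\<close> modulo \<open>r\<close>, is prime to \<open>r\<close>, and
  the multiplicity of \<open>r\<close> is unchanged in \<open>y ^ n + 1\<close>.\<close>

lemma odd_mult_primes_Suc_subset:
  fixes y n :: nat
  assumes "odd n"
  shows "odd_mult_primes (y + 1) \<subseteq> prime_factors n \<union> odd_mult_primes (y ^ n + 1)"
proof
  fix r assume r: "r \<in> odd_mult_primes (y + 1)"
  then have "prime r" "r dvd y + 1" using odd_mult_primes_subset by (auto simp: odd_mult_primes_def)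
  obtain Q where Q: "y ^ n + 1 = (y + 1) * Q" "[Q = n] (mod (y + 1))"
    using odd_power_plus_one_factor[OF assms] by blast
  have "Q > 0" using Q(1) by (cases Q) auto
  have "n > 0" using assms by (cases n) auto
  show "r \<in> prime_factors n \<union> odd_mult_primes (y ^ n + 1)"
  proof (cases "r dvd n")
    case True
    then show ?thesis using \<open>prime r\<close> \<open>n > 0\<close> by (auto simp: prime_factors_dvd)
  next
    case False
    have "[Q = n] (mod r)" using Q(2) \<open>r dvd y + 1\<close> by (rule cong_dvd_modulus_nat)
    then have "\<not> r dvd Q" using False cong_dvd_iff by blast
    then have "multiplicity r (y ^ n + 1) = multiplicity r (y + 1)"
      unfolding Q(1) using \<open>prime r\<close> \<open>Q > 0\<close> by (intro multiplicity_mult_not_dvd) auto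
    then show ?thesis using r by (simp add: odd_mult_primes_def)
  qed
qed

lemma not_is_square_Suc_square:
  fixes b :: nat
  assumes "b > 0"
  shows "\<not> is_square (b\<^sup>2 + 1)"
proof
  assume "is_square (b\<^sup>2 + 1)"
  then obtain y where y: "b\<^sup>2 + 1 = y\<^sup>2" by (auto elim: is_nth_powerE)
  then have "b\<^sup>2 < y\<^sup>2" by simp
  then have "b < y" by (rule power_less_imp_less_base) simp
  then have "(b + 1)\<^sup>2 \<le> y\<^sup>2" by (intro power_mono) auto
  then show False using y assms by (simp add: power2_eq_square)
qed

text \<open>These primes are 1 modulo \<open>2 ^ (U + 1)\<close>, so k of them force (2^(U+1))^k to
  be at most a^(2^U); the logarithm of this is the quotient in \<open>s0\<close>.\<close>

lemma card_prime_factors_le_s0: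
  fixes a U n :: nat
  assumes "even a" "a \<ge> 2" "\<And>p. prime p \<Longrightarrow> p dvd n \<Longrightarrow> p dvd a ^ (2 ^ U) + 1"
  shows "card (prime_factors n) \<le> s0 a U"
proof -
  have q: "2 ^ (U + 1) dvd p - 1" if "prime p" "p dvd n" for p
  proof -
    have "p \<noteq> 2" using assms(1) assms(3)[OF that] by auto
    moreover have "p dvd a ^ (2 ^ U * 1) + 1" using assms(3)[OF that] by simp
    ultimately show ?thesis
      using prime_dvd_power_plus_one_order[OF that(1) _ odd_one, of a U] by (metis dvd_mult_left)
  qed
  let ?k = "card (prime_factors n)"
  have "(2 ^ (U + 1)) ^ ?k \<le> a ^ (2 ^ U)"
    using assms q by (intro power_card_prime_divisors_le) auto
  then have "real ((2 ^ (U + 1)) ^ ?k) \<le> real (a ^ (2 ^ U))" by (simp only: of_nat_le_iff)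
  then have "ln ((2 ^ (U + 1)) ^ ?k) \<le> ln (real a ^ (2 ^ U))"
    using assms(2) by (subst ln_le_cancel_iff) auto
  then have "real ?k * (real (U + 1) * ln 2) \<le> 2 ^ U * ln (real a)"
    using assms(2) by (simp add: ln_realpow del: power_Suc)
  then have "real ?k \<le> 2 ^ U * ln (real a) / (real (U + 1) * ln 2)"
    by (subst pos_le_divide_eq) auto
  then show ?thesis unfolding s0_def by (simp add: le_nat_floor)
qed

text \<open>Write v = W S, with \<open>S\<close> collecting the primes that divide
  \<open>A + 1\<close>. The odd-multiplicity primes of \<open>A ^ W + 1\<close> either divide
  \<open>S\<close> or survive in the full number, where at most one is allowed. So \<open>W\<close>
  has at most as many primes as \<open>S\<close>, or one more if \<open>A + 1\<close> is a square,
  and \<open>S\<close> has at most \<open>s0 a U\<close>.\<close>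

lemma card_prime_factors_le_t0:
  fixes a U v :: nat
  assumes "even a" "a \<ge> 2" "odd v" "card (odd_mult_primes (a ^ (2 ^ U * v) + 1)) \<le> 1"
  shows "card (prime_factors v) \<le> t0 a U"
proof -
  define A where "A = a ^ (2 ^ U)"
  have A: "even A" "A > 0" using assms by (auto simp: A_def)
  have "v > 0" using assms(3) by (cases v) auto
  then obtain W S where v: "v = W * S" and W: "\<And>p. prime p \<Longrightarrow> p dvd W \<Longrightarrow> \<not> p dvd A + 1"
    and S: "\<And>p. prime p \<Longrightarrow> p dvd S \<Longrightarrow> p dvd A + 1"
    using coprime_split_by_primes[of v "\<lambda>p. \<not> p dvd A + 1"] by blast
  have odds: "odd W" "odd S" "W > 0" "S > 0" using assms(3) v \<open>v > 0\<close> by auto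
  have s: "card (prime_factors S) \<le> s0 a U"
    using S unfolding A_def by (intro card_prime_factors_le_s0[OF assms(1,2)])
  have "card (prime_factors W) + (if is_square (A + 1) then 0 else 1) \<le> card (odd_mult_primes (A ^ W + 1))"
    by (rule card_odd_mult_primes_power_plus_one_ge[OF A odds(1) W])
  also have "\<dots> \<le> card (prime_factors S \<union> odd_mult_primes ((A ^ W) ^ S + 1))"
    by (intro card_mono odd_mult_primes_Suc_subset odds) (simp add: finite_odd_mult_primes)
  also have "(A ^ W) ^ S = a ^ (2 ^ U * v)" by (simp add: A_def v power_mult)
  also have "card (prime_factors S \<union> odd_mult_primes (a ^ (2 ^ U * v) + 1))
      \<le> card (prime_factors S) + card (odd_mult_primes (a ^ (2 ^ U * v) + 1))" by (rule card_Un_le)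
  also have "\<dots> \<le> card (prime_factors S) + 1" using assms(4) by simp
  finally have w: "card (prime_factors W) + (if is_square (A + 1) then 0 else 1) \<le> card (prime_factors S) + 1" .
  have "prime_factors v = prime_factors W \<union> prime_factors S"
    using odds by (simp add: v prime_factorization_mult)
  then have vc: "card (prime_factors v) \<le> card (prime_factors W) + card (prime_factors S)"
    by (simp add: card_Un_le)
  have "U = 0 \<and> is_square (a + 1)" if sq: "is_square (A + 1)"
  proof -
    have "U = 0"
    proof (rule ccontr)
      assume "U \<noteq> 0"
      then obtain k where "U = Suc k" by (cases U) auto
      then have "A = (a ^ (2 ^ k))\<^sup>2" by (simp add: A_def power_mult[symmetric] mult.commute)
      then show False using not_is_square_Suc_square[of "a ^ (2 ^ k)"] assms(2) sq by simp
    qed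
    then show ?thesis using sq by (simp add: A_def)
  qed
  then show ?thesis using w s vc by (auto simp: t0_def split: if_splits)
qed

text \<open>
  For \<open>U > 0\<close> a prime \<open>l\<close> of \<open>v\<close> not dividing \<open>N\<close> would split \<open>N\<close> into two coprime factors, neither of
  them a square.
\<close>

lemma prime_dvd_exponent_cong:
  fixes a U v l :: nat
  assumes "even a" "a \<ge> 2" "odd v" "card (odd_mult_primes (a ^ (2 ^ U * v) + 1)) \<le> 1" "prime l" "l dvd v"
  shows "2 ^ (U + 1) dvd l - 1"
proof (cases "U = 0")
  case True
  have "odd l" using assms(3,6) by auto
  then show ?thesis using True by simp
next
  case False
  then obtain k where k: "U = Suc k" by (cases U) auto
  have "odd l" "l > 1" using assms(3,5,6) prime_gt_1_nat by auto
  obtain w where w: "v = w * l" using assms(6) by (metis dvdE mult.commute)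
  have "w > 0" using w assms(3) by (cases w) auto
  \<comment> \<open>For \<open>U > 0\<close> the base \<open>x\<close> is the square of
    \<open>b\<close>, so \<open>x + 1\<close> is not a square.\<close>
  define b where "b = a ^ (2 ^ k * w)"
  define x where "x = b\<^sup>2"
  have xa: "x = a ^ (2 ^ U * w)" by (simp add: x_def b_def k power_mult[symmetric] mult_ac)
  have x: "even x" "x > 0" using assms \<open>w > 0\<close> by (auto simp: xa)
  have N: "a ^ (2 ^ U * v) + 1 = x ^ l + 1" by (simp add: xa w power_mult[symmetric] mult_ac)
  obtain Q where Q: "x ^ l + 1 = (x + 1) * Q" "[Q = l] (mod (x + 1))"
    using odd_power_plus_one_factor[OF \<open>odd l\<close>] by blast
  have "Q > 0" using Q(1) by (cases Q) auto
  have "l dvd x + 1"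
  proof (rule ccontr)
    assume "\<not> l dvd x + 1"
    then have "coprime l (x + 1)" using assms(5) by (simp add: prime_imp_coprime)
    then have "coprime Q (x + 1)" using cong_imp_coprime[OF cong_sym[OF Q(2)]] by blast
    then have cop: "coprime (x + 1) Q" by (simp add: coprime_commute)
    have "odd_mult_primes Q \<noteq> {}"
      using odd_power_plus_one_quotient_not_square[OF x \<open>odd l\<close> \<open>l > 1\<close> Q(1)] \<open>Q > 0\<close> odd_mult_primes_nonempty by blast
    moreover have "b > 0" using assms(2) by (simp add: b_def)
    then have "odd_mult_primes (x + 1) \<noteq> {}" unfolding x_def by (intro odd_mult_primes_nonempty not_is_square_Suc_square) auto
    ultimately have "card (odd_mult_primes Q) > 0" "card (odd_mult_primes (x + 1)) > 0" by (simp_all add: card_gt_0_iff finite_odd_mult_primes)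
    moreover have "card (odd_mult_primes (x ^ l + 1)) = card (odd_mult_primes (x + 1)) + card (odd_mult_primes Q)"
      unfolding Q(1) by (rule card_odd_mult_primes_mult_coprime[OF cop]) (use \<open>Q > 0\<close> in auto)
    ultimately show False using assms(4) unfolding N by linarith
  qed
  \<comment> \<open>So \<open>l\<close> is itself a prime factor of the number, and its residue
    follows from the order lemma.\<close>
  then have "l dvd a ^ (2 ^ U * v) + 1" unfolding N Q(1) by (rule dvd_mult2)
  moreover have "l \<noteq> 2" using \<open>odd l\<close> by auto
  ultimately show ?thesis
    using prime_dvd_power_plus_one_order[OF assms(5) _ assms(3), of a U] by (metis dvd_mult_left)
qed

section \<open>The numbers \<open>2 ^ v + 1\<close> with \<open>v\<close> odd\<close>

lemma ex_odd_mult_primes_cong_3_mod_4: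
  fixes n :: nat
  assumes "[n = 3] (mod 4)"
  shows "\<exists>p\<in>odd_mult_primes n. [p = 3] (mod 4)"
proof (rule ccontr)
  assume *: "\<not> (\<exists>p\<in>odd_mult_primes n. [p = 3] (mod 4))"
  have "n > 0" using assms by (cases n) (auto simp: cong_def)
  have "odd n" using assms unfolding cong_def by presburger
  have "[p ^ multiplicity p n = 1] (mod 4)" if "p \<in> prime_factors n" for p
  proof -
    have p: "prime p" "p dvd n" using that by auto
    then have "odd p" using \<open>odd n\<close> by auto
    then have "p mod 4 = 1 \<or> p mod 4 = 3" by presburger
    then consider "p mod 4 = 1" | "p mod 4 = 3" by blast
    then show ?thesis
    proof cases
      case 1
      then have "[p ^ multiplicity p n = 1 ^ multiplicity p n] (mod 4)" by (intro cong_pow) (simp add: cong_def)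
      then show ?thesis by simp
    next
      case 2
      then have "even (multiplicity p n)" using * p by (auto simp: odd_mult_primes_def cong_def)
      then obtain k where k: "multiplicity p n = 2 * k" by (elim evenE)
      have "[p ^ 2 = 3 ^ 2] (mod 4)" using 2 by (intro cong_pow) (simp add: cong_def)
      then have "[p ^ 2 = 1] (mod 4)" by (simp add: cong_def)
      then have "[(p ^ 2) ^ k = 1 ^ k] (mod 4)" by (intro cong_pow)
      then show ?thesis by (simp add: k power_mult)
    qed
  qed
  then have "[(\<Prod>p\<in>prime_factors n. p ^ multiplicity p n) = (\<Prod>p\<in>prime_factors n. 1)] (mod 4)"
    by (intro cong_prod)
  then have "[n = 1] (mod 4)" using \<open>n > 0\<close> by (simp add: prime_factorization_nat[symmetric])
  with assms show False by (simp add: cong_def)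
qed

lemma not_k_perfect_two_power_odd:
  fixes v m :: nat
  assumes "odd v"
  shows "\<not> k_perfect (4 * m + 2) (2 ^ v + 1)"
proof
  define N :: nat where "N = 2 ^ v + 1"
  assume "k_perfect (4 * m + 2) (2 ^ v + 1)"
  then have sig: "sigma N = (4 * m + 2) * N" by (simp add: k_perfect_def N_def)
  have "v > 0" using assms by (cases v) auto
  then have "odd N" by (simp add: N_def)
  note eu = euler_form[OF this sig]
  have three: "prime (3::nat)" by simp
  \<comment> \<open>Such an \<open>r\<close> either divides \<open>v\<close> or keeps odd
    multiplicity in \<open>N\<close>; the latter would make it the Euler prime, which is 1 modulo
    4.\<close>
  have lift: "r dvd v" if w: "w dvd v" and r: "r \<in> odd_mult_primes (2 ^ w + 1)" "[r = 3] (mod 4)" for w r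
  proof -
    obtain u where u: "v = w * u" using w by (elim dvdE)
    have "r \<notin> odd_mult_primes N" using eu(2)[of r] r(2) by (auto simp: cong_def)
    moreover have "r \<in> prime_factors u \<union> odd_mult_primes ((2 ^ w) ^ u + 1)"
      using odd_mult_primes_Suc_subset[of u "2 ^ w"] r(1) assms u by auto
    ultimately have "r \<in> prime_factors u" by (simp add: N_def u power_mult)
    then show ?thesis by (auto simp: u)
  qed
  have only3: "l = 3" if l: "prime l" "l dvd v" for l
  proof (rule ccontr)
    assume "l \<noteq> 3"
    define X where "X = prime_factors v - {3}"
    have "l \<in> X" using l \<open>l \<noteq> 3\<close> \<open>v > 0\<close> by (auto simp: X_def prime_factors_dvd)
    define t where "t = Max X"
    have "t \<in> X" unfolding t_def using \<open>l \<in> X\<close> by (intro Max_in) (auto simp: X_def)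
    then have t: "prime t" "t dvd v" "t \<noteq> 3" by (auto simp: X_def)
    have "odd t" using t(2) assms by auto
    have "t > 3" using t \<open>odd t\<close> prime_ge_2_nat[of t] by (metis even_numeral le_antisym linorder_not_less nat_less_le not_less_eq_eq numeral_2_eq_2 numeral_3_eq_3)
    obtain Q where Q: "2 ^ t + 1 = (2 + 1) * Q" "[Q = t] (mod (2 + 1))"
      using odd_power_plus_one_factor[OF \<open>odd t\<close>, of 2] by blast
    \<comment> \<open>Reducing \<open>3 * Q = 2 ^ t + 1\<close> modulo 4 gives residue 3 for
      \<open>Q\<close>.\<close>
    have "(8::nat) dvd 2 ^ t" using \<open>t > 3\<close> le_imp_power_dvd[of 3 t "2::nat"] by simp
    then obtain c :: nat where "2 ^ t = 8 * c" by (elim dvdE)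
    then have "8 * c + 1 = 3 * Q" using Q(1) by simp
    then have "Q mod 4 = 3" by presburger
    then have "[Q = 3] (mod 4)" by (simp add: cong_def)
    then obtain r where r: "r \<in> odd_mult_primes Q" "[r = 3] (mod 4)" using ex_odd_mult_primes_cong_3_mod_4 by blast
    have rQ: "prime r" "r dvd Q" using r(1) odd_mult_primes_subset by (auto simp: odd_mult_primes_def)
    have "\<not> 3 dvd Q"
    proof
      assume "3 dvd Q"
      then have "3 dvd t" using Q(2) by (simp add: cong_dvd_iff)
      then show False using t by (metis primes_dvd_imp_eq two_is_prime_nat three)
    qed
    then have "r \<noteq> 3" using rQ by auto
    then have "\<not> r dvd 2 + 1" using rQ(1) by (metis numeral_plus_one primes_dvd_imp_eq semiring_norm(5) three)
    have "Q > 0" using Q(1) by (cases Q) auto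
    have "multiplicity r (2 ^ t + 1) = multiplicity r Q"
      using multiplicity_mult_not_dvd[of r "2 + 1" Q] \<open>\<not> r dvd 2 + 1\<close> rQ(1) \<open>Q > 0\<close> unfolding Q(1)
      by (simp add: mult.commute)
    then have "r \<in> odd_mult_primes (2 ^ t + 1)" using r(1) by (simp add: odd_mult_primes_def)
    then have "r dvd v" using lift[OF t(2)] r(2) by blast
    then have "r \<in> X" using rQ \<open>r \<noteq> 3\<close> \<open>v > 0\<close> by (auto simp: X_def prime_factors_dvd)
    then have "r \<le> t" unfolding t_def by (intro Max_ge) (auto simp: X_def)
    have "r \<noteq> 2" using \<open>r dvd v\<close> assms by auto
    moreover have "r dvd 2 ^ (2 ^ 0 * t) + 1" unfolding power_0 mult_1 Q(1) using rQ(2) by (rule dvd_mult)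
    ultimately obtain d where d: "d dvd t" "2 ^ (0 + 1) * d dvd r - 1" "r dvd 2 ^ (2 ^ 0 * d) + 1"
      using prime_dvd_power_plus_one_order[OF rQ(1) _ \<open>odd t\<close>, of 2 0] by blast
    \<comment> \<open>\<open>d = 1\<close> would mean that \<open>r\<close> divides 3. Hence
      \<open>d = t\<close> and \<open>r\<close> exceeds \<open>2 * t\<close>, against the maximality
      of \<open>t\<close>.\<close>
    have "d \<noteq> 1" using d(3) \<open>\<not> r dvd 2 + 1\<close> by auto
    then have "d = t" using d(1) t(1) by (auto simp: prime_nat_iff)
    then have "2 * t dvd r - 1" using d(2) by simp
    then have "2 * t \<le> r - 1" using prime_gt_1_nat[OF rQ(1)] by (intro dvd_imp_le) auto
    then show False using \<open>r \<le> t\<close> \<open>t > 3\<close> by linarith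
  qed
  show False
  proof (cases "9 dvd v")
    case True
    \<comment> \<open>Here 2^9 + 1 = 513 = 27 * 19 and 19 is 3 modulo 4, so 19 would divide
      \<open>v\<close>, whose only possible prime is 3.\<close>
    have "multiplicity 19 (19 * 27 :: nat) = Suc (multiplicity 19 (27 :: nat))"
      by (intro multiplicity_times_same) auto
    then have "multiplicity 19 (513 :: nat) = 1" by (simp add: not_dvd_imp_multiplicity_0)
    then have "19 \<in> odd_mult_primes (2 ^ 9 + 1)" by (simp add: odd_mult_primes_def)
    then have "19 dvd v" using lift[OF True] by (simp add: cong_def)
    then show False using only3[of 19] by simp
  next
    case False
    have "v = 1 \<or> v = 3"
    proof (rule ccontr)
      assume v: "\<not> (v = 1 \<or> v = 3)"
      then obtain l where "prime l" "l dvd v" using prime_factor_nat by blast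
      then have "3 dvd v" using only3 by metis
      then obtain u where u: "v = 3 * u" by (elim dvdE)
      then obtain l where "prime l" "l dvd u" using prime_factor_nat[of u] v by auto
      then have "3 dvd u" using only3[of l] u by auto
      then show False using False u by auto
    qed
    then have "N = 3 \<or> N = 3\<^sup>2" by (auto simp: N_def)
    moreover have "sigma (3 ^ 1) = 4" "sigma (3 ^ 2) = 13"
      by (simp_all only: sigma_prime_power three) (simp_all add: numeral_2_eq_2)
    ultimately show False using sig by auto
  qed
qed

subsection \<open>Explicit estimates\<close>

text \<open>The quotient is the slope of the chord from 1 to 1 + x of the concave logarithm.\<close>

lemma ln_Suc_div_antimono:
  fixes x y :: real
  assumes "0 < x" "x \<le> y"
  shows "ln (1 + y) / y \<le> ln (1 + x) / x"
proof -
  define t where "t = x / y"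
  have t: "0 \<le> t" "t \<le> 1" "t * y = x" using assms by (auto simp: t_def)
  have "(1 - t) * ln 1 + t * ln (1 + y) \<le> ln ((1 - t) *\<^sub>R 1 + t *\<^sub>R (1 + y))"
    using t assms by (intro concave_onD[OF ln_concave]) auto
  also have "(1 - t) *\<^sub>R 1 + t *\<^sub>R (1 + y) = 1 + x" using t by (simp add: algebra_simps)
  finally have "x / y * ln (1 + y) \<le> ln (1 + x)" by (simp add: t_def)
  then show ?thesis using assms by (simp add: field_simps)
qed

lemma ln_2_ge: "ln (2::real) \<ge> 0.693"
  using ln_approx_bounds[of 2 3] by (simp add: eval_nat_numeral)

lemma ln_3_le: "ln (3::real) \<le> 1.099"
  using ln_approx_bounds[of 3 4] by (simp add: eval_nat_numeral)

lemma ln_5_le: "ln (5::real) \<le> 1.62"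
  using ln_approx_bounds[of 5 4] by (simp add: eval_nat_numeral)

text \<open>A comparison with the integral of ln x / x. \<open>c_const\<close> is normalized to give
  equality at \<open>n = 3\<close>; the case \<open>n = 2\<close> lies before the decreasing range
  and is checked numerically.\<close>

lemma sum_ln_div_le:
  assumes "n \<ge> 2"
  shows "(\<Sum>i=1..n. ln (real i) / real i) \<le> (ln (real n))\<^sup>2 / 2 + c_const"
proof (cases "n = 2")
  case True
  have "(ln (2::real))\<^sup>2 \<ge> 0.693\<^sup>2" using ln_2_ge by (intro power_mono) auto
  moreover have "0 \<le> (1.099 - ln (3::real)) * (ln 3 + 1.099 - 2/3)"
    using ln_3_le ln3_gt_1 by (intro mult_nonneg_nonneg) auto
  \<comment> \<open>Monotonicity of t^2/2 - t/3 between ln 3 and 1.099, in factored form.\<close>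
  then have "(ln (3::real))\<^sup>2 / 2 - ln 3 / 3 \<le> 1.099\<^sup>2 / 2 - 1.099 / 3"
    by (simp add: power2_eq_square field_simps)
  ultimately show ?thesis using True by (simp add: c_const_def numeral_2_eq_2 power2_eq_square)
next
  case False
  with assms have "n \<ge> 3" by simp
  then show ?thesis
  proof (induction n rule: dec_induct)
    case base
    show ?case by (simp add: c_const_def numeral_3_eq_3)
  next
    case (step n)
    have n: "real n \<ge> 3" using step by simp
    \<comment> \<open>This leads to ln(n+1)/(n+1) at most ln(n)/n for n at least 3.\<close>
    have "real n * ln (1 + 1 / real n) \<le> real n * (1 / real n)"
      using n by (intro mult_left_mono ln_add_one_self_le_self) auto
    also have "\<dots> < ln 3" using n ln3_gt_1 by simp
    also have "\<dots> \<le> ln (real n)" using n by (intro ln_mono) auto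
    finally have *: "real n * ln (1 + 1 / real n) \<le> ln (real n)" by simp
    have "1 + 1 / real n = (real n + 1) / real n" using n by (simp add: field_simps)
    then have "ln (1 + 1 / real n) = ln (real n + 1) - ln (real n)"
      using n by (simp add: ln_div)
    with * have **: "real n * ln (real n + 1) \<le> (real n + 1) * ln (real n)" by (simp add: algebra_simps)
    have "2 / (2 * real n + 1) \<le> ln (real n + 1) - ln (real n)"
      using ln_inverse_approx_ge[of "real n" "real n + 1"] n by (simp add: add_ac)
    then have "2 / (2 * real n + 1) * (ln (real n + 1) + ln (real n))
        \<le> (ln (real n + 1) - ln (real n)) * (ln (real n + 1) + ln (real n))"
      using n by (intro mult_right_mono) auto
    moreover have "2 * (ln (real n + 1) / (real n + 1)) \<le> 2 / (2 * real n + 1) * (ln (real n + 1) + ln (real n))"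
      using n ** by (simp add: field_simps)
    ultimately have "ln (real (Suc n)) / real (Suc n) \<le> (ln (real (Suc n)))\<^sup>2 / 2 - (ln (real n))\<^sup>2 / 2"
      by (simp add: power2_eq_square algebra_simps)
    then show ?case using step.IH by simp
  qed
qed

lemma sum_exceptional_terms_le:
  assumes "odd v"
  shows "(\<Sum>d | d dvd v. (1 - ln (ln (real (2 ^ (U + 1) * d)))) / real (2 ^ (U + 1) * d)) \<le> C_const U"
proof -
  define q where "q = (2::nat) ^ (U + 1)"
  have q: "even q" "q \<ge> 2" by (auto simp: q_def)
  let ?f = "\<lambda>x::nat. (1 - ln (ln (real x))) / real x"
  have "v > 0" using assms by (cases v) auto
  have e: "exp (1::real) < 2.72" using e_less_272 by simp
  have e': "exp (1::real) > 2.71" using e_approx_32 by (simp add: abs_if split: if_split_asm)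
  have small: "0 \<le> ?f x" if "2 \<le> x" "x \<le> 14" for x
  proof -
    have "(14::real) \<le> 2.71 * (2.71 * (1 + 0.71 + 0.71\<^sup>2 / 2))" by (simp add: power2_eq_square)
    also have "\<dots> \<le> exp 1 * (exp 1 * exp 0.71)"
      using e' exp_lower_Taylor_quadratic[of "0.71::real"] by (intro mult_mono) auto
    also have "\<dots> = exp 2.71" by (simp flip: exp_add)
    also have "\<dots> \<le> exp (exp 1)" using e' by simp
    finally have "ln 14 \<le> ln (exp (exp (1::real)))" by (intro ln_mono) auto
    moreover have "ln (real x) \<le> ln 14" using that by (intro ln_mono) auto
    ultimately have "ln (real x) \<le> exp 1" by simp
    then have "ln (ln (real x)) \<le> ln (exp 1)" using that by (intro ln_mono) auto
    then show ?thesis by simp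
  qed
  have large: "?f x \<le> 0" if "x \<ge> 16" for x
  proof -
    have "exp 1 \<le> 4 * ln (2::real)" using e ln_2_ge by simp
    also have "\<dots> = ln (2 ^ 4)" by (subst ln_realpow) auto
    also have "\<dots> \<le> ln (real x)" using that by (intro ln_mono) auto
    finally have "ln (exp 1) \<le> ln (ln (real x))" by (intro ln_mono) auto
    then show ?thesis by (simp add: divide_nonpos_nonneg)
  qed
  define J where "J = {j. q * (2 * j + 1) < 16}"
  define K where "K = {j. 2 * j + 1 dvd v}"
  have "j < 16" if "j \<in> J" for j
  proof -
    have "1 * (2 * j + 1) \<le> q * (2 * j + 1)" using q by (intro mult_right_mono) auto
    then show ?thesis using that by (simp add: J_def)
  qed
  then have finJ: "finite J" by (intro finite_subset[of J "{..<16}"]) auto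
  have bij: "bij_betw (\<lambda>j. 2 * j + 1) K {d. d dvd v}"
  proof (rule bij_betwI[where g = "\<lambda>d. d div 2"])
    show "2 * (d div 2) + 1 = d" if "d \<in> {d. d dvd v}" for d
      using that assms by (auto simp: odd_two_times_div_two_succ)
    then show "(\<lambda>d. d div 2) \<in> {d. d dvd v} \<rightarrow> K" by (auto simp: K_def)
  qed (auto simp: K_def)
  then have finK: "finite K" using \<open>v > 0\<close> by (simp add: bij_betw_finite)
  have "(\<Sum>d | d dvd v. ?f (q * d)) = (\<Sum>j\<in>K. ?f (q * (2 * j + 1)))"
    by (rule sum.reindex_bij_betw[OF bij, symmetric])
  also have "\<dots> = (\<Sum>j\<in>K \<inter> J. ?f (q * (2 * j + 1))) + (\<Sum>j\<in>K - J. ?f (q * (2 * j + 1)))"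
    using finK by (subst sum.Int_Diff[of K _ J]) auto
  also have "\<dots> \<le> (\<Sum>j\<in>J. ?f (q * (2 * j + 1))) + 0"
  proof (rule add_mono)
    show "(\<Sum>j\<in>K \<inter> J. ?f (q * (2 * j + 1))) \<le> (\<Sum>j\<in>J. ?f (q * (2 * j + 1)))"
    proof (rule sum_mono2)
      show "0 \<le> ?f (q * (2 * j + 1))" if "j \<in> J - K \<inter> J" for j
      proof (rule small)
        have "2 * 1 \<le> q * (2 * j + 1)" using q by (intro mult_mono) auto
        then show "2 \<le> q * (2 * j + 1)" by simp
        have "q * (2 * j + 1) < 16" using that by (auto simp: J_def)
        moreover have "even (q * (2 * j + 1))" using q by simp
        ultimately show "q * (2 * j + 1) \<le> 14" by presburger
      qed
    qed (use finJ in auto)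
    show "(\<Sum>j\<in>K - J. ?f (q * (2 * j + 1))) \<le> 0"
    proof (intro sum_nonpos large)
      show "16 \<le> q * (2 * j + 1)" if "j \<in> K - J" for j
        using that unfolding J_def by (simp add: not_less)
    qed
  qed
  finally show ?thesis unfolding C_const_def q_def J_def by simp
qed

section \<open>Divisor sums over an exponent whose primes are few and lie in one residue
  class\<close>

lemma real_prime_diff_1: "prime p \<Longrightarrow> real p - 1 = real (p - 1)"
  using prime_ge_1_nat[of p] by simp

lemma sum_inverse_divisors_le_exp:
  assumes "v > 0" "m > 0" "T > 0" "card (prime_factors v) \<le> T" "\<And>l. prime l \<Longrightarrow> l dvd v \<Longrightarrow> m dvd l - 1"
  shows "(\<Sum>d | d dvd v. 1 / real d) \<le> exp ((1 + ln (real T)) / real m)"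
proof -
  have "ln (\<Sum>d | d dvd v. 1 / real d) \<le> (\<Sum>l\<in>prime_factors v. 1 / (real l - 1))"
    using ln_sum_inverse_divisors[OF assms(1)] by blast
  also have "\<dots> = (\<Sum>l\<in>prime_factors v. 1 / real (l - 1))"
    by (intro sum.cong refl arg_cong[where f = "\<lambda>x. 1 / x"] real_prime_diff_1) auto
  also have "\<dots> \<le> (\<Sum>i=1..card (prime_factors v). 1 / real (m * i))"
    using assms prime_gt_1_nat
    by (intro sum_residue_class_one_le[where g = "\<lambda>i. 1 / real i"]) (auto simp: frac_le)
  also have "\<dots> \<le> (\<Sum>i=1..T. 1 / real (m * i))" using assms by (intro sum_mono2) auto
  also have "\<dots> = (\<Sum>i=1..T. 1 / real i) / real m" by (simp add: sum_divide_distrib mult.commute)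
  also have "\<dots> \<le> (1 + ln (real T)) / real m"
    using harm_le_Suc_ln[OF assms(3)] by (intro divide_right_mono) auto
  finally have "exp (ln (\<Sum>d | d dvd v. 1 / real d)) \<le> exp ((1 + ln (real T)) / real m)" by simp
  then show ?thesis using sum_inverse_divisors_pos[OF assms(1)] by simp
qed

text \<open>Written at x = l - 1, the summand ln(1+x)/x is decreasing, so the extreme primes would
  be 1 + m, 1 + 2m and so on.\<close>

lemma sum_ln_prime_factors_le:
  assumes "m > 0" "card (prime_factors v) \<le> T" "\<And>l. prime l \<Longrightarrow> l dvd v \<Longrightarrow> m dvd l - 1"
  shows "(\<Sum>l\<in>prime_factors v. ln (real l) / (real l - 1)) \<le> (\<Sum>i=1..T. ln (1 + real (m * i)) / real (m * i))"
proof -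
  have "(\<Sum>l\<in>prime_factors v. ln (real l) / (real l - 1)) = (\<Sum>l\<in>prime_factors v. ln (1 + real (l - 1)) / real (l - 1))"
  proof (intro sum.cong refl)
    fix l assume "l \<in> prime_factors v"
    then have "real l - 1 = real (l - 1)" by (intro real_prime_diff_1) auto
    moreover from this have "real l = 1 + real (l - 1)" by linarith
    ultimately show "ln (real l) / (real l - 1) = ln (1 + real (l - 1)) / real (l - 1)" by metis
  qed
  also have "\<dots> \<le> (\<Sum>i=1..card (prime_factors v). ln (1 + real (m * i)) / real (m * i))"
    using assms prime_gt_1_nat
    by (intro sum_residue_class_one_le[where g = "\<lambda>i. ln (1 + real i) / real i"])
      (auto intro!: ln_Suc_div_antimono)
  also have "\<dots> \<le> (\<Sum>i=1..T. ln (1 + real (m * i)) / real (m * i))" using assms by (intro sum_mono2) auto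
  finally show ?thesis .
qed

lemma ln_abundancy_less_C_const:
  fixes a U v :: nat
  assumes "even a" "a \<ge> 2" "odd v"
  defines "N \<equiv> a ^ (2 ^ U * v) + 1"
  shows "ln (real (sigma N) / real N) < C_const U
    + ((\<Sum>d | d dvd v. 1 / real d) * ln (2 ^ U * ln (real a)) + (\<Sum>d | d dvd v. ln (real d) / real d)) / 2 ^ (U + 1)"
proof -
  let ?f = "\<lambda>d. (1 - ln (ln (real (2 ^ (U + 1) * d)))) / real (2 ^ (U + 1) * d)"
  let ?L = "ln (2 ^ U * ln (real a))"
  have "v > 0" using assms(3) by (cases v) auto
  have "ln (real (sigma N) / real N)
      < (\<Sum>d | d dvd v. (1 + ln (real d) + ?L - ln (ln (real (2 ^ (U + 1) * d)))) / real (2 ^ (U + 1) * d))"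
    unfolding N_def by (rule ln_abundancy_less[OF assms(1-3)])
  also have "\<dots> = (\<Sum>d | d dvd v. ?f d + (1 / real d * ?L + ln (real d) / real d) / 2 ^ (U + 1))"
  proof (intro sum.cong refl)
    fix d assume "d \<in> {d. d dvd v}"
    then have "d > 0" using \<open>v > 0\<close> by (auto intro: dvd_pos_nat)
    then show "(1 + ln (real d) + ?L - ln (ln (real (2 ^ (U + 1) * d)))) / real (2 ^ (U + 1) * d)
        = ?f d + (1 / real d * ?L + ln (real d) / real d) / 2 ^ (U + 1)"
      by (simp add: add_divide_distrib diff_divide_distrib mult.commute)
  qed
  also have "\<dots> = (\<Sum>d | d dvd v. ?f d)
      + ((\<Sum>d | d dvd v. 1 / real d) * ?L + (\<Sum>d | d dvd v. ln (real d) / real d)) / 2 ^ (U + 1)"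
    by (simp only: sum.distrib sum_distrib_right sum_divide_distrib[symmetric])
  finally show ?thesis using sum_exceptional_terms_le[OF assms(3), of U] by linarith
qed

section \<open>The numbers \<open>2 ^ n + 1\<close> with \<open>n\<close> even\<close>

lemma k_perfect_abundancy: "k_perfect k N \<Longrightarrow> real (sigma N) / real N = real k"
  by (simp add: k_perfect_def)

text \<open>The left side is the bound obtained below for the logarithm of the abundancy when
  \<open>a = 2\<close>. It is close to ln 2 at \<open>U = 1\<close>, hence the separate
  case.\<close>

lemma two_power_numeric_bound:
  assumes "U \<ge> 1"
  shows "exp ((1 + real U * ln 2) / 2 ^ (U + 1)) * (1 + (real U - 1) * ln 2 + ln (1 + 2 ^ (U + 1)) / 2) / 2 ^ (U + 1) < ln 2"
proof (cases "U = 1")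
  case True
  have "exp ((1 + ln (2::real)) / 4) ^ 4 = exp (1 + ln 2)"
    by (simp add: exp_of_nat_mult[symmetric] field_simps)
  also have "\<dots> = exp 1 * 2" by (simp add: exp_add)
  also have "\<dots> \<le> 1.53 ^ 4" using e_less_272 by (simp add: eval_nat_numeral)
  finally have "exp ((1 + ln (2::real)) / 4) \<le> 1.53" by (rule power_le_imp_le_base[of _ 3, simplified]) auto
  then have "exp ((1 + ln 2) / 4) * (1 + ln 5 / 2) \<le> 1.53 * (1 + 1.62 / 2 :: real)"
    using ln_5_le by (intro mult_mono) auto
  then show ?thesis using True ln_2_ge by simp
next
  case False
  with assms have "U \<ge> 2" by simp
  have l2: "ln (2::real) \<le> 0.7" using ln2_le_25_over_36 by simp
  \<comment> \<open>0.3 and 0.3875 give equality at \<open>U = 2\<close>; afterwards the right sides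
    double while the left sides grow linearly.\<close>
  have p: "1 + 0.7 * real U \<le> 0.3 * 2 ^ (U + 1)" "1 + 1.05 * real U \<le> 0.3875 * 2 ^ (U + 1)"
    using \<open>U \<ge> 2\<close> by (induction U rule: dec_induct) (simp_all add: field_simps)
  have "1 + real U * ln 2 \<le> 1 + real U * 0.7" using l2 by (intro add_left_mono mult_left_mono) auto
  also have "\<dots> \<le> 0.3 * 2 ^ (U + 1)" using p(1) by (simp add: mult.commute)
  finally have "(1 + real U * ln 2) / 2 ^ (U + 1) \<le> 0.3" by (simp add: field_simps)
  then have "exp ((1 + real U * ln 2) / 2 ^ (U + 1)) \<le> exp 0.3" by simp
  also have "\<dots> \<le> 1.43"
  proof -
    have "0.7 \<le> exp (- 0.3 :: real)" using exp_ge_add_one_self[of "-0.3"] by simp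
    then have "0.7 * exp (0.3::real) \<le> exp (- 0.3) * exp 0.3" by (intro mult_right_mono) auto
    also have "\<dots> = 1" by (simp flip: exp_add)
    finally show ?thesis by simp
  qed
  finally have E: "exp ((1 + real U * ln 2) / 2 ^ (U + 1)) \<le> 1.43" .
  have "1 \<le> (2::real) ^ (U + 1)" by (intro one_le_power) simp
  then have "ln (1 + 2 ^ (U + 1) :: real) \<le> ln (2 ^ (U + 2))" by (intro ln_mono) auto
  also have "\<dots> = (real U + 2) * ln 2" by (subst ln_realpow) auto
  also have "\<dots> \<le> (real U + 2) * 0.7" using l2 by (intro mult_left_mono) auto
  finally have "ln (1 + 2 ^ (U + 1) :: real) / 2 \<le> 0.35 * real U + 0.7" by (simp add: field_simps)
  moreover have "(real U - 1) * ln 2 \<le> (real U - 1) * 0.7"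
    using l2 \<open>U \<ge> 2\<close> by (intro mult_left_mono) auto
  ultimately have "1 + (real U - 1) * ln 2 + ln (1 + 2 ^ (U + 1)) / 2 \<le> 1 + 1.05 * real U"
    by (simp add: algebra_simps)
  also note p(2)
  finally have B: "1 + (real U - 1) * ln 2 + ln (1 + 2 ^ (U + 1)) / 2 \<le> 0.3875 * 2 ^ (U + 1)" .
  have "0 \<le> ln (1 + 2 ^ (U + 1) :: real)" by (intro ln_ge_zero) auto
  moreover have "0 \<le> (real U - 1) * ln 2" using \<open>U \<ge> 2\<close> by (intro mult_nonneg_nonneg) auto
  ultimately have "exp ((1 + real U * ln 2) / 2 ^ (U + 1)) * (1 + (real U - 1) * ln 2 + ln (1 + 2 ^ (U + 1)) / 2)
      \<le> 1.43 * (0.3875 * 2 ^ (U + 1))"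
    using E B by (intro mult_mono) auto
  then have "exp ((1 + real U * ln 2) / 2 ^ (U + 1)) * (1 + (real U - 1) * ln 2 + ln (1 + 2 ^ (U + 1)) / 2) / 2 ^ (U + 1)
      \<le> 1.43 * (0.3875 * 2 ^ (U + 1)) / 2 ^ (U + 1)" by (intro divide_right_mono) auto
  also have "\<dots> < ln 2" using ln_2_ge by simp
  finally show ?thesis .
qed

lemma t0_two_le:
  assumes "U \<ge> 1"
  shows "t0 2 U \<le> 2 ^ U"
proof -
  have "real (s0 2 U) \<le> 2 ^ U / real (U + 1)" by (simp add: s0_def)
  also have "\<dots> \<le> 2 ^ U / 2" using assms by (intro divide_left_mono) auto
  finally have "2 * real (s0 2 U) \<le> 2 ^ U" by simp
  then have "real (2 * s0 2 U) \<le> real (2 ^ U)" by simp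
  then have "2 * s0 2 U \<le> 2 ^ U" by (simp only: of_nat_le_iff)
  then show ?thesis using assms by (simp add: t0_def)
qed

lemma not_k_perfect_two_power_even:
  fixes U v m :: nat
  assumes "odd v" "U \<ge> 1"
  shows "\<not> k_perfect (4 * m + 2) (2 ^ (2 ^ U * v) + 1)"
proof
  define N :: nat where "N = 2 ^ (2 ^ U * v) + 1"
  define q :: nat where "q = 2 ^ (U + 1)"
  assume kp: "k_perfect (4 * m + 2) (2 ^ (2 ^ U * v) + 1)"
  then have sig: "sigma N = (4 * m + 2) * N" by (simp add: k_perfect_def N_def)
  have "v > 0" using assms by (cases v) auto
  then have "odd N" by (simp add: N_def)
  have eu: "card (odd_mult_primes (2 ^ (2 ^ U * v) + 1)) \<le> 1"
    using euler_form(1)[OF \<open>odd N\<close> sig] by (simp add: N_def)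
  have t: "card (prime_factors v) \<le> 2 ^ U"
    using card_prime_factors_le_t0[OF _ _ assms(1) eu] t0_two_le[OF assms(2)] by simp
  have lq: "q dvd l - 1" if "prime l" "l dvd v" for l
    unfolding q_def using prime_dvd_exponent_cong[OF _ _ assms(1) eu that] by simp
  let ?H = "\<Sum>d | d dvd v. 1 / real d"
  let ?G = "\<Sum>d | d dvd v. ln (real d) / real d"
  let ?E = "exp ((1 + real U * ln 2) / 2 ^ (U + 1))"
  \<comment> \<open>Since \<open>2 ^ (U + 1) * d\<close> is at least 4, \<open>B\<close> bounds 1 +
    ln(2^U ln 2) - ln(ln(2^(U+1) d)).\<close>
  define B where "B = 1 + (real U - 1) * ln 2"
  have B: "B \<ge> 0" using assms(2) by (auto simp: B_def intro!: add_nonneg_nonneg mult_nonneg_nonneg)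
  have "ln 2 \<le> ln (real (4 * m + 2))" by (intro ln_mono) auto
  also have "\<dots> = ln (real (sigma N) / real N)" using k_perfect_abundancy[OF kp] by (simp add: N_def)
  also have "\<dots> < (\<Sum>d | d dvd v. (1 + ln (real d) + ln (2 ^ U * ln (real 2)) - ln (ln (real (2 ^ (U + 1) * d)))) / real (2 ^ (U + 1) * d))"
    unfolding N_def by (rule ln_abundancy_less) (use assms in auto)
  also have "\<dots> \<le> (\<Sum>d | d dvd v. (1 / real d * B + ln (real d) / real d) / 2 ^ (U + 1))"
  proof (intro sum_mono)
    fix d assume "d \<in> {d. d dvd v}"
    then have d: "d \<ge> 1" using \<open>v > 0\<close> by (auto intro: dvd_pos_nat simp: Suc_le_eq)
    have "2 * ln (2::real) = ln (2 ^ 2)" by (subst ln_realpow) auto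
    also have "\<dots> \<le> ln (real (2 ^ (U + 1) * d))"
    proof (intro ln_mono)
      have "(2::nat) ^ 2 * 1 \<le> 2 ^ (U + 1) * d" using d assms(2) by (intro mult_mono power_increasing) auto
      then have "real (2 ^ 2 * 1) \<le> real (2 ^ (U + 1) * d)" by (simp only: of_nat_le_iff)
      then show "(2::real) ^ 2 \<le> real (2 ^ (U + 1) * d)" by simp
    qed auto
    finally have "ln (2 * ln 2) \<le> ln (ln (real (2 ^ (U + 1) * d)))" by (intro ln_mono) auto
    moreover have "ln (2 ^ U * ln 2) - ln (2 * ln 2) = (real U - 1) * ln (2::real)"
      by (simp add: ln_mult ln_realpow algebra_simps)
    ultimately have "(1 + ln (real d) + ln (2 ^ U * ln (real 2)) - ln (ln (real (2 ^ (U + 1) * d)))) / real (2 ^ (U + 1) * d)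
        \<le> (B + ln (real d)) / real (2 ^ (U + 1) * d)"
      by (intro divide_right_mono) (auto simp: B_def)
    also have "\<dots> = (1 / real d * B + ln (real d) / real d) / 2 ^ (U + 1)"
      by (simp add: add_divide_distrib mult.commute)
    finally show "(1 + ln (real d) + ln (2 ^ U * ln (real 2)) - ln (ln (real (2 ^ (U + 1) * d)))) / real (2 ^ (U + 1) * d)
        \<le> (1 / real d * B + ln (real d) / real d) / 2 ^ (U + 1)" .
  qed
  also have "\<dots> = (?H * B + ?G) / 2 ^ (U + 1)"
    by (simp only: sum.distrib sum_distrib_right sum_divide_distrib[symmetric])
  also have "\<dots> \<le> (?E * (B + ln (1 + 2 ^ (U + 1)) / 2)) / 2 ^ (U + 1)"
  proof (intro divide_right_mono)
    have H: "?H \<le> ?E"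
      using sum_inverse_divisors_le_exp[OF \<open>v > 0\<close> _ _ t lq] by (simp add: q_def ln_realpow)
    let ?L = "\<Sum>l\<in>prime_factors v. ln (real l) / (real l - 1)"
    have "?L \<le> (\<Sum>i=1..2 ^ U. ln (1 + real (q * i)) / real (q * i))"
      by (rule sum_ln_prime_factors_le[OF _ t lq]) (simp_all add: q_def)
    \<comment> \<open>All \<open>2 ^ U\<close> terms are replaced by the first; since
      \<open>q\<close> is twice their number, the sum is ln(1+q)/2.\<close>
    also have "\<dots> \<le> (\<Sum>i=1..(2::nat) ^ U. ln (1 + real q) / real q)"
    proof (intro sum_mono ln_Suc_div_antimono)
      fix i :: nat assume "i \<in> {1..2 ^ U}"
      then have "q * 1 \<le> q * i" by (intro mult_left_mono) auto
      then show "real q \<le> real (q * i)" by (simp only: of_nat_le_iff mult_1_right)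
    qed (simp add: q_def)
    also have "\<dots> = ln (1 + 2 ^ (U + 1)) / 2" by (simp add: q_def)
    finally have L: "?L \<le> ln (1 + 2 ^ (U + 1)) / 2" .
    have "?H * B + ?G \<le> ?H * B + ?H * ?L" using sum_ln_divisors_le[OF \<open>v > 0\<close>] by simp
    also have "\<dots> \<le> ?H * (B + ln (1 + 2 ^ (U + 1)) / 2)"
      using L sum_inverse_divisors_pos[OF \<open>v > 0\<close>] by (simp add: distrib_left mult_left_mono)
    also have "\<dots> \<le> ?E * (B + ln (1 + 2 ^ (U + 1)) / 2)"
      using H B by (intro mult_right_mono add_nonneg_nonneg) auto
    finally show "?H * B + ?G \<le> ?E * (B + ln (1 + 2 ^ (U + 1)) / 2)" .
  qed simp
  also have "\<dots> < ln 2" unfolding B_def by (rule two_power_numeric_bound[OF assms(2)])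
  finally show False .
qed

lemma not_k_perfect_two_power:
  fixes n m :: nat
  assumes "n > 0"
  shows "\<not> k_perfect (4 * m + 2) (2 ^ n + 1)"
proof -
  obtain U v where n: "n = 2 ^ U * v" "odd v"
    using prime_power_decompose[OF assms two_is_prime_nat] by metis
  then show ?thesis
    using not_k_perfect_two_power_odd[OF n(2)] not_k_perfect_two_power_even[OF n(2)]
    by (cases "U = 0") auto
qed

section \<open>The bounds for general \<open>a\<close>\<close>

lemma k_perfect_pure_power_bound:
  fixes a U m :: nat
  assumes "a \<ge> 2" "odd (a ^ (2 ^ U) + 1)" "k_perfect (4 * m + 2) (a ^ (2 ^ U) + 1)"
  shows "ln (real a) > (real (4 * m + 2) / exp (C_const U)) ^ (2 ^ (U + 1)) / 2 ^ U"
proof -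
  let ?X = "real (4 * m + 2) / exp (C_const U)"
  let ?L = "2 ^ U * ln (real a)"
  have "even a" using assms(2) by auto
  have L: "?L > 0" using assms(1) by simp
  \<comment> \<open>For \<open>v = 1\<close> the reciprocal divisor sum is 1 and the log-weighted
    one is 0.\<close>
  have "ln (real (4 * m + 2)) < C_const U + ln ?L / 2 ^ (U + 1)"
    using ln_abundancy_less_C_const[OF \<open>even a\<close> assms(1) odd_one, of U] k_perfect_abundancy[OF assms(3)]
    by simp
  then have "ln (real (4 * m + 2)) - C_const U < ln ?L / 2 ^ (U + 1)" by simp
  also have "ln (real (4 * m + 2)) - C_const U = ln ?X" by (simp add: ln_div del: of_nat_add)
  finally have "2 ^ (U + 1) * ln ?X < ln ?L" by (simp add: field_simps)
  moreover have "2 ^ (U + 1) * ln ?X = ln (?X ^ (2 ^ (U + 1)))"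
    by (subst ln_realpow) auto
  ultimately have "ln (?X ^ (2 ^ (U + 1))) < ln ?L" by linarith
  moreover have "?X > 0" by (intro divide_pos_pos) auto
  then have "?X ^ (2 ^ (U + 1)) > 0" by (rule zero_less_power)
  ultimately have "?X ^ (2 ^ (U + 1)) < ?L" using L ln_less_cancel_iff by blast
  then show ?thesis by (simp add: field_simps del: power_Suc)
qed

lemma k_perfect_general_bound:
  fixes a U v m :: nat
  assumes "a \<ge> 2" "odd v" "odd (a ^ (2 ^ U * v) + 1)" "k_perfect (4 * m + 2) (a ^ (2 ^ U * v) + 1)"
  shows "ln (real (4 * m + 2)) - C_const U <
    exp ((1 + ln (real (t0 a U))) / 2 ^ (U + 1)) / 2 ^ (U + 1)
    * (ln (2 ^ U * ln (real a)) + real (U + 1) * (1 + ln (real (t0 a U))) * ln 2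
       + (ln (real (t0 a U)))\<^sup>2 / 2 + c_const)"
proof -
  define N where "N = a ^ (2 ^ U * v) + 1"
  define q :: nat where "q = 2 ^ (U + 1)"
  define T where "T = t0 a U"
  have "v > 0" using assms(2) by (cases v) auto
  have "even a" using assms(3) \<open>v > 0\<close> by auto
  \<comment> \<open>Excluding 2 leaves a at least 4. Then ln(2^U ln a) is nonnegative, which is what
    permits replacing the reciprocal divisor sum by its upper bound.\<close>
  have "a \<noteq> 2" using assms(4) not_k_perfect_two_power[of "2 ^ U * v" m] \<open>v > 0\<close> by auto
  then have a: "a \<ge> 4" using assms(1) \<open>even a\<close> by (cases "a = 3") auto
  have sig: "sigma N = (4 * m + 2) * N" using assms(4) by (simp add: k_perfect_def N_def)
  have eu: "card (odd_mult_primes (a ^ (2 ^ U * v) + 1)) \<le> 1"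
    using euler_form(1)[of N] assms(3) sig by (simp add: N_def)
  have t: "card (prime_factors v) \<le> T"
    unfolding T_def by (rule card_prime_factors_le_t0[OF \<open>even a\<close> assms(1,2) eu])
  have lq: "q dvd l - 1" if "prime l" "l dvd v" for l
    unfolding q_def by (rule prime_dvd_exponent_cong[OF \<open>even a\<close> assms(1,2) eu that])
  have T: "T \<ge> 2"
  proof -
    have "U + 1 \<le> 2 ^ U" by (induction U) auto
    then have "real (U + 1) \<le> 2 ^ U" by (metis of_nat_le_iff of_nat_numeral of_nat_power)
    then have "real (U + 1) * ln 2 \<le> 2 ^ U * ln (real a)"
      using assms(1) by (intro mult_mono) auto
    then have "1 \<le> 2 ^ U * ln (real a) / (real (U + 1) * ln 2)"
      by (subst pos_le_divide_eq) auto
    then have "s0 a U \<ge> 1" unfolding s0_def by (simp add: le_nat_floor)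
    then show ?thesis by (auto simp: T_def t0_def)
  qed
  let ?H = "\<Sum>d | d dvd v. 1 / real d"
  let ?G = "\<Sum>d | d dvd v. ln (real d) / real d"
  let ?E = "exp ((1 + ln (real T)) / 2 ^ (U + 1))"
  let ?L = "ln (2 ^ U * ln (real a))"
  define R where "R = real (U + 1) * (1 + ln (real T)) * ln 2 + (ln (real T))\<^sup>2 / 2 + c_const"
  have "ln 3 \<le> ln (real a)" using a by (intro ln_mono) auto
  then have "ln (real a) \<ge> 1" using ln3_gt_1 by linarith
  then have "1 * 1 \<le> 2 ^ U * ln (real a)" by (intro mult_mono) auto
  then have L: "?L \<ge> 0" by simp
  have H: "?H \<le> ?E"
    using sum_inverse_divisors_le_exp[OF \<open>v > 0\<close> _ _ t lq] T by (simp add: q_def)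
  let ?S = "\<Sum>l\<in>prime_factors v. ln (real l) / (real l - 1)"
  have S: "?S \<le> R"
  proof -
    have "?S \<le> (\<Sum>i=1..T. ln (1 + real (q * i)) / real (q * i))"
      by (rule sum_ln_prime_factors_le[OF _ t lq]) (simp_all add: q_def)
    also have "\<dots> \<le> (\<Sum>i=1..T. real (U + 1) * ln 2 * (1 / real i) + ln (real i) / real i)"
    proof (intro sum_mono)
      fix i assume "i \<in> {1..T}"
      then have i: "i \<ge> 1" by simp
      define x where "x = real (q * i)"
      have "2 * 1 \<le> q * i" using i by (intro mult_mono) (auto simp: q_def)
      then have "real 2 \<le> real (q * i)" by (simp only: of_nat_le_iff mult_1_right)
      then have x: "x \<ge> 2" by (simp add: x_def)
      \<comment> \<open>Gives ln(1+x) at most 2 ln x, hence at most q ln x; this factor q cancels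
        the one in x = q i.\<close>
      have "2 * x \<le> x * x" using x by (intro mult_right_mono) auto
      then have "1 + x \<le> x ^ 2" unfolding power2_eq_square using x by linarith
      then have "ln (1 + x) \<le> ln (x ^ 2)" using x by (intro ln_mono) auto
      also have "\<dots> = 2 * ln x" using x by (simp add: ln_realpow)
      also have "\<dots> \<le> real q * ln x" using x by (intro mult_right_mono) (auto simp: q_def)
      finally have "ln (1 + x) / x \<le> real q * ln x / x" using x by (intro divide_right_mono) auto
      also have "\<dots> = ln x / real i" using i by (simp add: x_def q_def)
      also have "ln x = real (U + 1) * ln 2 + ln (real i)"
        using i by (simp add: x_def q_def ln_mult ln_realpow algebra_simps)
      also have "\<dots> / real i = real (U + 1) * ln 2 * (1 / real i) + ln (real i) / real i"
        by (simp add: add_divide_distrib)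
      finally show "ln (1 + real (q * i)) / real (q * i) \<le> real (U + 1) * ln 2 * (1 / real i) + ln (real i) / real i"
        by (simp only: x_def)
    qed
    also have "\<dots> = real (U + 1) * ln 2 * (\<Sum>i=1..T. 1 / real i) + (\<Sum>i=1..T. ln (real i) / real i)"
      by (simp only: sum.distrib sum_distrib_left)
    also have "\<dots> \<le> real (U + 1) * ln 2 * (1 + ln (real T)) + ((ln (real T))\<^sup>2 / 2 + c_const)"
      using T by (intro add_mono mult_left_mono harm_le_Suc_ln sum_ln_div_le) auto
    also have "\<dots> = R" by (simp add: R_def algebra_simps)
    finally show ?thesis .
  qed
  have "?S \<ge> 0"
  proof (intro sum_nonneg)
    fix l assume "l \<in> prime_factors v"
    then have "1 \<le> l" by (intro prime_ge_1_nat) auto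
    then show "0 \<le> ln (real l) / (real l - 1)" by (intro divide_nonneg_nonneg ln_ge_zero) auto
  qed
  then have "R \<ge> 0" using S by simp
  have "?H * ?L + ?G \<le> ?H * ?L + ?H * ?S" using sum_ln_divisors_le[OF \<open>v > 0\<close>] by simp
  also have "\<dots> \<le> ?H * (?L + R)"
    using S sum_inverse_divisors_pos[OF \<open>v > 0\<close>] by (simp add: distrib_left mult_left_mono)
  also have "\<dots> \<le> ?E * (?L + R)" using H L \<open>R \<ge> 0\<close> by (intro mult_right_mono) auto
  finally have main: "(?H * ?L + ?G) / 2 ^ (U + 1) \<le> ?E * (?L + R) / 2 ^ (U + 1)" by (intro divide_right_mono) auto
  have "ln (real (4 * m + 2)) < C_const U + (?H * ?L + ?G) / 2 ^ (U + 1)"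
    using ln_abundancy_less_C_const[OF \<open>even a\<close> assms(1,2), of U] k_perfect_abundancy[OF assms(4)] by simp
  then have "ln (real (4 * m + 2)) - C_const U < ?E * (?L + R) / 2 ^ (U + 1)" using main by linarith
  also have "\<dots> = ?E / 2 ^ (U + 1) * (?L + R)" by simp
  finally show ?thesis unfolding R_def T_def by (simp only: add.assoc)
qed

theorem theorem1:
  fixes a m U :: nat
  assumes "a \<ge> 2"
  shows "(\<forall>n::nat. n = 2 ^ U \<longrightarrow> odd (a ^ n + 1) \<longrightarrow> k_perfect (4 * m + 2) (a ^ n + 1) \<longrightarrow>
            ln (real a) > (real (4 * m + 2) / exp (C_const U)) ^ (2 ^ (U + 1)) / 2 ^ U)
       \<and> (\<forall>n v :: nat. n = 2 ^ U * v \<longrightarrow> v > 1 \<longrightarrow> odd v \<longrightarrow>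
            odd (a ^ n + 1) \<longrightarrow> k_perfect (4 * m + 2) (a ^ n + 1) \<longrightarrow>
            ln (real (4 * m + 2)) - C_const U <
              exp ((1 + ln (real (t0 a U))) / 2 ^ (U + 1)) / 2 ^ (U + 1)
              * (ln (2 ^ U * ln (real a)) + real (U + 1) * (1 + ln (real (t0 a U))) * ln 2
                 + (ln (real (t0 a U)))\<^sup>2 / 2 + c_const))
       \<and> (\<forall>n m' :: nat. n > 0 \<longrightarrow> \<not> k_perfect (4 * m' + 2) (2 ^ n + 1))"
  using k_perfect_pure_power_bound[OF assms, of U m] k_perfect_general_bound[OF assms, of _ U m]
    not_k_perfect_two_power
  by blast

end
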